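(* Let $c$ be a constant with $c<100\log 2-2$. For every $\varepsilon>0$ there exists an integer $n_0$ with the following property. Let $A$ be a finite multiset of integers with $|A|>1$. Suppose that $B$ is an eventually periodic infinite multiset of integers (with some eventual period), and that the representation function $R_{A,B}$ is eventually periodic with eventual period $m$. If $n=\mathrm{diam}(A)+m\ge n_0$ and $\sum_{a\in A}w_A(a)\le n^{c}$, then there exists an eventual period $k$ of $B$ such that \[\log k\le n^{\frac13+\varepsilon}.\]
   Context: A multiset $S$ of integers is described by its weight function $w_S:\mathbb{Z}\to\mathbb{Z}_{\ge 0}$ ($w_S(n)$ = number of occurrences of $n$ in $S$); elements of $S$ are the integers of positive weight, and $|A|$ denotes the number of distinct elements of $A$. $\mathrm{diam}(A)=\max(A)-\min(A)$. For a finite multiset $A$ and a multiset $B$, $R_{A,B}(n)=\sum_{n=a+b,\ a\in A,\ b\in B} w_A(a)w_B(b)$. A multiset $B$ is eventually periodic with eventual period $k\in\mathbb{Z}_{>0}$ if there is $n_1\in\mathbb{Z}$ with $w_B(n+k)=w_B(n)$ for all $n\ge n_1$; the function $R_{A,B}$ is eventually periodic with eventual period $m\in\mathbb{Z}_{>0}$ if there is $n_1\in\mathbb{Z}$ with $R_{A,B}(n+m)=R_{A,B}(n)$ for all $n\ge n_1$. $\log$ is the natural logarithm. *)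

theory Defs
  imports Complex_Main "HOL-Library.Multiset"
begin

text \<open>
  Finite multisets of integers are represented by \<open>int multiset\<close>, the weight function
  of \<open>A\<close> being \<open>count A\<close>. Since \<open>int multiset\<close> only has finite members, a
  possibly infinite multiset of integers is represented by its weight function
  \<open>B :: int \<Rightarrow> nat\<close>.
\<close>

definition elems :: "(int \<Rightarrow> nat) \<Rightarrow> int set" where
  "elems B = {n. B n > 0}"

definition diam :: "int multiset \<Rightarrow> int" where
  "diam A = Max (set_mset A) - Min (set_mset A)"

definition rep_fun :: "int multiset \<Rightarrow> (int \<Rightarrow> nat) \<Rightarrow> int \<Rightarrow> nat" where
  "rep_fun A B n =
     (\<Sum>(a, b) \<in> {(a, b). a \<in># A \<and> b \<in> elems B \<and> n = a + b}. count A a * B b)"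

text \<open>
  The index set in \<open>rep_fun\<close> is finite even when \<open>B\<close> is infinite, so the sum never
  takes the default value of sums over infinite sets.
\<close>

lemma finite_rep_fun_index:
  "finite {(a, b). a \<in># A \<and> b \<in> elems B \<and> n = a + b}"
proof (rule finite_subset)
  show "{(a, b). a \<in># A \<and> b \<in> elems B \<and> n = a + b} \<subseteq> (\<lambda>a. (a, n - a)) ` set_mset A"
    by auto
qed simp

definition eventual_period :: "(int \<Rightarrow> nat) \<Rightarrow> int \<Rightarrow> bool" where
  "eventual_period f k \<longleftrightarrow> k > 0 \<and> (\<exists>n\<^sub>1. \<forall>n\<ge>n\<^sub>1. f (n + k) = f n)"

definition eventually_periodic :: "(int \<Rightarrow> nat) \<Rightarrow> bool" where
  "eventually_periodic f \<longleftrightarrow> (\<exists>k. eventual_period f k)"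

end

(*
  Write A(x) for the polynomial with coefficients w_A read from the top of A downwards. As a shift
  operator, (x^m - 1) A(x) annihilates the weight function of B near infinity, and so does x^(k_0) - 1
  for some k_0. Hence B has as an eventual period every common multiple of m and of the orders d of
  the roots of unity that are roots of A(x). The primitive d-th roots are all roots when one of them is,
  so the sum of totient d over these orders is at most n, and it remains to bound the number of primes
  that divide some such d.

  Let mu e be the multiplicity of the primitive e-th roots of unity in A(x). Taking the norm of
  A(x) / Phi_e(x)^(mu e) at a primitive e-th root of unity, a factor Phi_{e p^i} with p not dividing e
  contributes p^(totient e), while synthetic division bounds every conjugate by A(1) n^(mu e). This gives
    sum of mu (e p^i) log p over all such p and i  <=  (c + mu e) log n.
  Applied to e with k distinct prime factors and counted over all e with totient e < n^(1/3), it
  gives by induction on k that the sum of mu e over the e with k prime factors is at most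
  (2 log_2 n)^k / k! times the number of these e, up to a constant. As k! <= e <= n, the first factor is
  n^o(1). A prime p > n^(1/3) dividing d = e p^i either has totient e < n^(1/3), and these are counted
  by the inequality above, or totient d >= n^(2/3) / 2, which happens for at most 2 n^(1/3) orders d.
*)
theory Submission
  imports Defs "Jordan_Normal_Form.Char_Poly" "HOL-Number_Theory.Totient" "HOL-Real_Asymp.Real_Asymp"
begin

hide_const (open) Module.smult

section \<open>Primitive roots of unity\<close>

text \<open>The exponent 1/3 is a balance. With cutoff \<open>y\<close>, there are at most
  \<open>y\<close> primes up to \<open>y\<close>, and the sum of totients leaves room for about
  \<open>n / y^2\<close> orders with totient at least \<open>y^2 / 2\<close>; the two agree at
  \<open>y = n^(1/3)\<close>. Counting primes suffices because every order is at most
  \<open>4 n^2\<close>, so the least common multiple of the orders is at most \<open>4 n^2\<close>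
  to the number of primes.

  The obstacle is the term \<open>mu e\<close> on the right of the norm inequality. Descending from
  \<open>e\<close> to 1, where \<open>mu\<close> vanishes because A(1) is the positive total weight,
  bounds a single \<open>mu e\<close> only by about (log_2 n)^k, with k the number of prime factors
  of \<open>e\<close>; for k near log n / log log n this is a power of n. Averaging over
  \<open>e\<close> repairs the loss: a number with k prime factors is reached from k smaller ones,
  and these choices supply the division by k!.

  The period itself does not see multiplicities, because x^(k_0) - 1 has only simple roots; k_0 may
  be huge, and no bound on it enters.\<close>

definition prim_roots :: "nat \<Rightarrow> complex set" where
  "prim_roots n = {z. \<forall>k. z ^ k = 1 \<longleftrightarrow> n dvd k}"

lemma prim_rootsD: "z \<in> prim_roots n \<Longrightarrow> z ^ k = 1 \<longleftrightarrow> n dvd k"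
  by (simp add: prim_roots_def)

lemma prim_roots_power_eq_1: "z \<in> prim_roots n \<Longrightarrow> z ^ n = 1"
  by (simp add: prim_rootsD)

text \<open>For \<open>n = 0\<close> the set \<open>prim_roots n\<close> consists of the numbers of
  infinite order together with 0, hence the positivity assumption here and below.\<close>

lemma prim_roots_norm: "z \<in> prim_roots n \<Longrightarrow> n > 0 \<Longrightarrow> norm z = 1"
  using prim_roots_power_eq_1[of z n] power_eq_1_iff[of z n] by simp

lemma prim_roots_nonzero: "z \<in> prim_roots n \<Longrightarrow> n > 0 \<Longrightarrow> z \<noteq> 0"
  using prim_roots_norm by fastforce

lemma finite_prim_roots: "n > 0 \<Longrightarrow> finite (prim_roots n)"
  by (rule finite_subset[OF _ finite_roots_unity[of n]]) (auto simp: prim_roots_power_eq_1)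

lemma prim_roots_unique: "z \<in> prim_roots a \<Longrightarrow> z \<in> prim_roots b \<Longrightarrow> a = b"
  using prim_rootsD[of z a a] prim_rootsD[of z a b] prim_rootsD[of z b a] prim_rootsD[of z b b]
  by (simp add: dvd_antisym)

lemma root_of_unity_primitive:
  assumes "z ^ N = (1::complex)" "N > 0"
  obtains n where "n > 0" "n dvd N" "z \<in> prim_roots n"
proof -
  define n where "n = (LEAST n. n > 0 \<and> z ^ n = 1)"
  have n: "n > 0 \<and> z ^ n = 1" unfolding n_def by (rule LeastI[of _ N]) (use assms in auto)
  have "z ^ k = 1 \<longleftrightarrow> n dvd k" for k
  proof -
    have "z ^ k = z ^ (n * (k div n)) * z ^ (k mod n)"
      unfolding power_add[symmetric] by simp
    also have "\<dots> = z ^ (k mod n)" using n by (simp add: power_mult)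
    finally have *: "z ^ k = z ^ (k mod n)" .
    show ?thesis
    proof
      assume "z ^ k = 1"
      then have "\<not> k mod n > 0" using * not_less_Least[of "k mod n" "\<lambda>n. n > 0 \<and> z ^ n = 1"] n
        by (auto simp flip: n_def)
      then show "n dvd k" by auto
    qed (use * in auto)
  qed
  then have "z \<in> prim_roots n" by (simp add: prim_roots_def)
  moreover from this have "n dvd N" using assms by (simp add: prim_rootsD)
  ultimately show ?thesis using that n by blast
qed

lemma prim_roots_power:
  assumes "z \<in> prim_roots n" "coprime k n"
  shows "z ^ k \<in> prim_roots n"
proof -
  have "coprime n k" using assms(2) by (rule coprime_imp_coprime) auto
  then show ?thesis
    using assms(1) by (simp add: prim_roots_def coprime_dvd_mult_right_iff flip: power_mult)
qed

lemma inj_on_prim_root_power: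
  assumes "z \<in> prim_roots n" "n > 0"
  shows "inj_on (\<lambda>k. z ^ k) {0<..n}"
proof (rule linorder_inj_onI)
  fix a b assume "a < b" "a \<in> {0<..n}" "b \<in> {0<..n}"
  show "z ^ a \<noteq> z ^ b"
  proof
    assume "z ^ a = z ^ b"
    also have "z ^ b = z ^ a * z ^ (b - a)" using \<open>a < b\<close> by (simp flip: power_add)
    finally have "z ^ (b - a) = 1" using prim_roots_nonzero[OF assms] by simp
    then have "n dvd b - a" using assms by (simp add: prim_rootsD)
    with \<open>a < b\<close> have "n \<le> b - a" by (intro dvd_imp_le) auto
    then show False using \<open>a \<in> _\<close> \<open>b \<in> _\<close> by auto
  qed
qed auto

lemma image_prim_root_power:
  assumes "z \<in> prim_roots n" "n > 0"
  shows "(\<lambda>k. z ^ k) ` {0<..n} = {w. w ^ n = 1}"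
proof (rule card_subset_eq)
  show "finite {w::complex. w ^ n = 1}" using assms by (intro finite_roots_unity) auto
  show "(\<lambda>k. z ^ k) ` {0<..n} \<subseteq> {w. w ^ n = 1}"
    using assms by (auto simp: prim_rootsD simp flip: power_mult)
  show "card ((\<lambda>k. z ^ k) ` {0<..n}) = card {w::complex. w ^ n = 1}"
    using card_image[OF inj_on_prim_root_power[OF assms]] assms by (simp add: card_roots_unity_eq)
qed

lemma bij_betw_prim_roots:
  assumes "z \<in> prim_roots n" "n > 0"
  shows "bij_betw (\<lambda>k. z ^ k) (totatives n) (prim_roots n)"
  unfolding bij_betw_def
proof
  show "inj_on (\<lambda>k. z ^ k) (totatives n)"
    using inj_on_prim_root_power[OF assms] by (rule inj_on_subset) (auto simp: totatives_def)
  show "(\<lambda>k. z ^ k) ` totatives n = prim_roots n"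
  proof (intro equalityI subsetI)
    fix w assume "w \<in> (\<lambda>k. z ^ k) ` totatives n"
    then show "w \<in> prim_roots n" using prim_roots_power[OF assms(1)] by (auto simp: totatives_def)
  next
    fix w assume w: "w \<in> prim_roots n"
    then have "w \<in> (\<lambda>k. z ^ k) ` {0<..n}"
      using image_prim_root_power[OF assms] prim_roots_power_eq_1 by auto
    then obtain k where k: "k \<in> {0<..n}" "w = z ^ k" by auto
    \<comment> \<open>Already \<open>w ^ (n div g) = 1\<close>, so order exactly \<open>n\<close>
      leaves no room for \<open>g > 1\<close>.\<close>
    define g where "g = gcd k n"
    have "w ^ (n div g) = z ^ (k * (n div g))" using k by (simp add: power_mult)
    also have "k * (n div g) = (k div g) * n"
      unfolding g_def by (simp add: div_mult_swap dvd_div_mult)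
    also have "z ^ \<dots> = 1" using assms by (simp add: prim_rootsD)
    finally have "n dvd n div g" using w by (simp add: prim_rootsD)
    moreover obtain h where h: "n = g * h" unfolding g_def using gcd_dvd2 by blast
    ultimately have "g * h dvd h" "h > 0" "g > 0" using assms(2) by auto
    then have "g * h \<le> h" by (intro dvd_imp_le)
    with \<open>h > 0\<close> \<open>g > 0\<close> have "g = 1" by simp
    then have "coprime k n" unfolding g_def by (simp only: coprime_iff_gcd_eq_1)
    then have "k \<in> totatives n" using k(1) by (simp add: totatives_def)
    then show "w \<in> (\<lambda>k. z ^ k) ` totatives n" using k by auto
  qed
qed

lemma prim_roots_eq_powers:
  assumes "z \<in> prim_roots n" "w \<in> prim_roots n" "n > 0"
  obtains k where "coprime k n" "w = z ^ k" "k > 0"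
  using bij_betw_prim_roots[OF assms(1,3)] assms(2) that
  by (auto simp: bij_betw_def totatives_def)

lemma prim_roots_cis:
  assumes "n > 0"
  shows "cis (2 * pi / n) \<in> prim_roots n"
proof -
  let ?z = "cis (2 * pi / n)"
  have zn: "?z ^ n = 1" using assms by (simp add: DeMoivre)
  have "?z ^ k = 1 \<longleftrightarrow> n dvd k" for k
  proof -
    have "?z ^ k = ?z ^ (n * (k div n)) * ?z ^ (k mod n)"
      unfolding power_add[symmetric] by simp
    also have "\<dots> = ?z ^ (k mod n)" using zn by (simp add: power_mult)
    also have "\<dots> = cis (2 * pi * real (k mod n) / n)" by (simp add: DeMoivre mult_ac)
    finally have *: "?z ^ k = cis (2 * pi * real (k mod n) / n)" .
    have "inj_on (\<lambda>k. cis (2 * pi * real k / n)) {..<n}"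
      using bij_betw_roots_unity[OF assms] by (simp add: bij_betw_def)
    from inj_onD[OF this, of "k mod n" 0] have "cis (2 * pi * real (k mod n) / n) = 1 \<Longrightarrow> k mod n = 0"
      using assms by simp
    moreover have "cis (2 * pi * real (k mod n) / n) = 1" if "n dvd k" using that by simp
    ultimately show ?thesis unfolding * by (auto simp only: mod_eq_0_iff_dvd)
  qed
  then show ?thesis by (simp add: prim_roots_def)
qed

lemma card_prim_roots: "n > 0 \<Longrightarrow> card (prim_roots n) = totient n"
  using bij_betw_same_card[OF bij_betw_prim_roots[OF prim_roots_cis]] by (simp add: totient_def)

text \<open>Injectivity holds since a quotient of two first components has order dividing both
  \<open>a\<close> and \<open>b\<close>. Surjectivity is by counting, from the multiplicativity of
  \<open>totient\<close>.\<close>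

lemma bij_betw_prim_roots_mult:
  assumes "coprime a b" "a > 0" "b > 0"
  shows "bij_betw (\<lambda>(x, y). x * y) (prim_roots a \<times> prim_roots b) (prim_roots (a * b))"
proof -
  have ba: "coprime b a" using assms(1) by (rule coprime_imp_coprime) auto
  have inj: "inj_on (\<lambda>(x, y). x * y) (prim_roots a \<times> prim_roots b)"
  proof (rule inj_onI, clarify)
    fix x y x' y' assume *: "x \<in> prim_roots a" "y \<in> prim_roots b" "x' \<in> prim_roots a" "y' \<in> prim_roots b"
      and eq: "x * y = x' * y'"
    define t where "t = x / x'"
    have nz: "x' \<noteq> 0" "y \<noteq> 0"
      using prim_roots_nonzero[OF *(3) assms(2)] prim_roots_nonzero[OF *(2) assms(3)] by simp_all
    then have t': "t = y' / y" using eq by (simp add: t_def frac_eq_eq mult.commute[of y'])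
    have ta: "t ^ a = 1" using *(1,3) by (simp add: t_def power_divide prim_roots_power_eq_1)
    have tb: "t ^ b = 1" using *(2,4) by (simp add: t' power_divide prim_roots_power_eq_1)
    obtain n where "n dvd a" "t \<in> prim_roots n"
      using root_of_unity_primitive[OF ta assms(2)] by blast
    moreover have "n dvd b" using prim_rootsD[OF calculation(2), of b] tb by simp
    ultimately have "n = 1" using coprime_common_divisor_nat[OF assms(1), of n] by simp
    then have "t = 1" using \<open>t \<in> _\<close> prim_roots_power_eq_1[of t 1] by simp
    then show "x = x' \<and> y = y'" using nz t_def t' by simp
  qed
  moreover have "(\<lambda>(x, y). x * y) ` (prim_roots a \<times> prim_roots b) = prim_roots (a * b)"
  proof (rule card_subset_eq)
    show "finite (prim_roots (a * b))" using assms by (intro finite_prim_roots) auto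
    show "(\<lambda>(x, y). x * y) ` (prim_roots a \<times> prim_roots b) \<subseteq> prim_roots (a * b)"
    proof clarify
      fix x y assume x: "x \<in> prim_roots a" and y: "y \<in> prim_roots b"
      have "(x * y) ^ k = 1 \<longleftrightarrow> a * b dvd k" for k
      proof
        assume 1: "(x * y) ^ k = 1"
        have "1 = ((x * y) ^ k) ^ a" using 1 by simp
        also have "\<dots> = x ^ (a * k) * y ^ (a * k)" by (simp only: power_mult_distrib power_mult[symmetric] mult.commute[of k])
        also have "x ^ (a * k) = 1" using x by (simp add: prim_rootsD)
        finally have "b dvd a * k" using y by (simp add: prim_rootsD)
        then have bk: "b dvd k" using ba by (simp add: coprime_dvd_mult_right_iff)
        have "1 = ((x * y) ^ k) ^ b" using 1 by simp
        also have "\<dots> = x ^ (b * k) * y ^ (b * k)" by (simp only: power_mult_distrib power_mult[symmetric] mult.commute[of k])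
        also have "y ^ (b * k) = 1" using y by (simp add: prim_rootsD)
        finally have "a dvd b * k" using x by (simp add: prim_rootsD)
        then have "a dvd k" using assms(1) by (simp add: coprime_dvd_mult_right_iff)
        then show "a * b dvd k" using bk assms(1) by (rule divides_mult)
      next
        assume "a * b dvd k"
        then have "a dvd k" "b dvd k" using dvd_mult_left dvd_mult_right by blast+
        then have "x ^ k = 1" "y ^ k = 1" using x y by (simp_all add: prim_rootsD)
        then show "(x * y) ^ k = 1" by (simp add: power_mult_distrib)
      qed
      then show "x * y \<in> prim_roots (a * b)" by (simp add: prim_roots_def)
    qed
    show "card ((\<lambda>(x, y). x * y) ` (prim_roots a \<times> prim_roots b)) = card (prim_roots (a * b))"
      using card_image[OF inj] assms by (simp add: card_cartesian_product card_prim_roots totient_mult_coprime)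
  qed
  ultimately show ?thesis by (simp add: bij_betw_def)
qed

section \<open>Divisibility by products of linear factors\<close>

lemma prod_linear_dvd:
  fixes p :: "'a :: idom poly"
  assumes "finite Z" "p \<noteq> 0" "\<And>z. z \<in> Z \<Longrightarrow> m z \<le> order z p"
  shows "(\<Prod>z\<in>Z. [:-z, 1:] ^ m z) dvd p"
  using assms
proof (induction Z arbitrary: p rule: finite_induct)
  case (insert z Z)
  have "[:-z, 1:] ^ m z dvd p" using insert.prems by (simp add: order_divides)
  then obtain q where q: "p = [:-z, 1:] ^ m z * q" by blast
  have "m x \<le> order x q" if "x \<in> Z" for x
  proof -
    have "order x p = order x ([:-z, 1:] ^ m z) + order x q"
      unfolding q by (rule order_mult) (use q insert.prems in auto)
    also have "order x ([:-z, 1:] ^ m z) = 0"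
      using that insert.hyps by (intro order_0I) (auto simp: poly_power)
    finally show ?thesis using insert.prems(2)[of x] that by simp
  qed
  then have "(\<Prod>z\<in>Z. [:-z, 1:] ^ m z) dvd q" using q insert.prems by (intro insert.IH) auto
  then show ?case using insert.hyps unfolding q by (simp add: mult_dvd_mono)
qed auto

lemma lead_coeff_prod_linear: "finite Z \<Longrightarrow> lead_coeff (\<Prod>z\<in>Z. [:-z, 1::'a::idom:]) = 1"
  by (induction Z rule: finite_induct) (auto simp: lead_coeff_mult simp del: mult_pCons_left)

lemma degree_prod_linear: "finite Z \<Longrightarrow> degree (\<Prod>z\<in>Z. [:-z, 1::'a::idom:]) = card Z"
proof (induction Z rule: finite_induct)
  case (insert z Z)
  have "(\<Prod>z\<in>Z. [:-z, 1::'a:]) \<noteq> 0" using insert.hyps by auto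
  then show ?case using insert by (simp del: mult_pCons_left add: degree_mult_eq)
qed auto

lemma monic_eq_prod_linear:
  fixes p :: "'a :: idom poly"
  assumes "finite Z" "lead_coeff p = 1" "degree p = card Z" "\<And>z. z \<in> Z \<Longrightarrow> poly p z = 0"
  shows "p = (\<Prod>z\<in>Z. [:-z, 1:])"
proof -
  have p0: "p \<noteq> 0" using assms by auto
  have "(\<Prod>z\<in>Z. [:-z, 1:] ^ 1) dvd p"
    using assms p0 by (intro prod_linear_dvd) (auto simp: Suc_le_eq order_gt_0_iff)
  then obtain q where q: "p = (\<Prod>z\<in>Z. [:-z, 1:]) * q" unfolding power_one_right by (rule dvdE)
  then have "q \<noteq> 0" using p0 by auto
  moreover have "(\<Prod>z\<in>Z. [:-z, 1:]) \<noteq> 0" using q p0 by auto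
  ultimately have "degree p = card Z + degree q"
    unfolding q using assms by (simp add: degree_mult_eq degree_prod_linear)
  then have "degree q = 0" using assms by simp
  moreover have "lead_coeff q = 1"
    using assms(2) lead_coeff_prod_linear[OF assms(1)] unfolding q lead_coeff_mult by simp
  ultimately have "q = 1" by (auto elim!: degree_eq_zeroE simp: one_pCons)
  then show ?thesis using q by simp
qed

lemma unity_poly_eq_prod:
  assumes "n > 0"
  shows "monom 1 n - 1 = (\<Prod>z\<in>{z::complex. z ^ n = 1}. [:-z, 1:])"
proof (rule monic_eq_prod_linear)
  have deg: "degree (monom 1 n - 1 :: complex poly) = n"
    using assms degree_add_eq_left[of "-1" "monom 1 n :: complex poly"] by (simp add: degree_monom_eq)
  show "lead_coeff (monom 1 n - 1 :: complex poly) = 1" using deg assms by simp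
  show "degree (monom 1 n - 1 :: complex poly) = card {z::complex. z ^ n = 1}"
    using deg assms by (simp add: card_roots_unity_eq)
qed (use assms in \<open>auto simp: poly_monom finite_roots_unity\<close>)

section \<open>Cyclotomic products for prime powers\<close>

lemma prod_unity_diff:
  fixes x y :: complex
  assumes "n > 0"
  shows "(\<Prod>w | w ^ n = 1. x - y * w) = x ^ n - y ^ n"
proof (cases "y = 0")
  case True
  then show ?thesis using assms by (simp add: card_roots_unity_eq)
next
  case False
  have "(x / y) ^ n - 1 = poly (monom 1 n - 1) (x / y)" by (simp add: poly_monom)
  also have "\<dots> = (\<Prod>w | w ^ n = 1. x / y - w)" by (simp add: unity_poly_eq_prod[OF assms] poly_prod)
  finally have "x ^ n - y ^ n = y ^ n * (\<Prod>w | w ^ n = 1. x / y - w)"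
    using False by (simp add: field_simps)
  moreover have "y ^ n = (\<Prod>w::complex | w ^ n = 1. y)"
    unfolding prod_constant card_roots_unity_eq[OF assms] ..
  moreover have "(\<Prod>w::complex | w ^ n = 1. y) * (\<Prod>w | w ^ n = 1. x / y - w) = (\<Prod>w | w ^ n = 1. x - y * w)"
    using False by (subst prod.distrib[symmetric]) (auto intro!: prod.cong simp: field_simps)
  ultimately show ?thesis by metis
qed

lemma roots_unity_prime_power_split:
  assumes "prime p"
  shows "{w::complex. w ^ (p ^ Suc i) = 1} = prim_roots (p ^ Suc i) \<union> {w. w ^ (p ^ i) = 1}"
    "prim_roots (p ^ Suc i) \<inter> {w. w ^ (p ^ i) = 1} = {}"
proof -
  have p: "p > 1" using assms by (rule prime_gt_1_nat)
  show "prim_roots (p ^ Suc i) \<inter> {w. w ^ (p ^ i) = 1} = {}"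
    using p by (auto simp: prim_rootsD dvd_power_iff_le simp del: power_Suc)
  show "{w::complex. w ^ (p ^ Suc i) = 1} = prim_roots (p ^ Suc i) \<union> {w. w ^ (p ^ i) = 1}"
  proof (intro equalityI subsetI)
    fix w :: complex assume "w \<in> {w. w ^ (p ^ Suc i) = 1}"
    then obtain n where n: "n dvd p ^ Suc i" "w \<in> prim_roots n"
      using root_of_unity_primitive[of w "p ^ Suc i"] p by auto
    then obtain j where j: "j \<le> Suc i" "n = p ^ j" using divides_primepow_nat[OF assms] by blast
    show "w \<in> prim_roots (p ^ Suc i) \<union> {w. w ^ (p ^ i) = 1}"
    proof (cases "j = Suc i")
      case False
      then have "n dvd p ^ i" using j p by (simp add: le_imp_power_dvd)
      then show ?thesis using n by (simp add: prim_rootsD)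
    qed (use j n in auto)
  next
    fix w :: complex assume "w \<in> prim_roots (p ^ Suc i) \<union> {w. w ^ (p ^ i) = 1}"
    moreover have "w ^ (p ^ Suc i) = (w ^ (p ^ i)) ^ p" by (simp add: mult.commute flip: power_mult)
    ultimately show "w \<in> {w. w ^ (p ^ Suc i) = 1}" using prim_roots_power_eq_1 by auto
  qed
qed

text \<open>The homogenized cyclotomic polynomial is a quotient of two differences; it is stated
  with the denominator cleared, since that may vanish.\<close>

lemma prod_prim_roots_prime_power:
  fixes x y :: complex
  assumes "prime p"
  shows "(\<Prod>w\<in>prim_roots (p ^ Suc i). x - y * w) * (x ^ (p ^ i) - y ^ (p ^ i)) = x ^ (p ^ Suc i) - y ^ (p ^ Suc i)"
proof -
  have p: "p > 0" using assms by (rule prime_gt_0_nat)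
  have "(\<Prod>w | w ^ (p ^ Suc i) = 1. x - y * w) =
    (\<Prod>w\<in>prim_roots (p ^ Suc i). x - y * w) * (\<Prod>w | w ^ (p ^ i) = 1. x - y * w)"
    unfolding roots_unity_prime_power_split(1)[OF assms]
    using roots_unity_prime_power_split(2)[OF assms] p
    by (intro prod.union_disjoint finite_prim_roots finite_roots_unity) (auto simp: Suc_le_eq)
  then show ?thesis using p by (simp add: prod_unity_diff del: power_Suc)
qed

text \<open>The telescoping identity reads 0 = 0 at the point 1, so the common factor
  \<open>monom 1 (p ^ i) - 1\<close> is cancelled among polynomials before evaluating the geometric
  sum that remains.\<close>

lemma prod_one_minus_prim_roots_prime_power:
  assumes "prime p"
  shows "(\<Prod>w\<in>prim_roots (p ^ Suc i). 1 - w) = of_nat p"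
proof -
  have p: "p > 0" using assms by (rule prime_gt_0_nat)
  let ?q = "(\<Prod>w\<in>prim_roots (p ^ Suc i). [:-w, 1:])" and ?r = "monom 1 (p ^ i) - 1 :: complex poly"
  have "?q * ?r = monom 1 (p ^ Suc i) - 1"
  proof (rule poly_ext)
    fix x :: complex
    show "poly (?q * ?r) x = poly (monom 1 (p ^ Suc i) - 1) x"
      using prod_prim_roots_prime_power[OF assms, of x 1 i] by (simp add: poly_prod poly_monom del: power_Suc)
  qed
  also have "\<dots> = (monom 1 (p ^ i)) ^ p - 1" by (simp add: monom_power mult.commute)
  also have "\<dots> = (\<Sum>k<p. monom 1 (p ^ i) ^ k) * ?r" by (simp add: power_diff_1_eq mult.commute)
  finally have "?q * ?r = (\<Sum>k<p. monom 1 (p ^ i) ^ k) * ?r" .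
  moreover have "?r \<noteq> 0"
  proof
    assume "?r = 0"
    then have "poly ?r 0 = 0" by simp
    then show False using p by (auto simp: poly_monom power_0_left)
  qed
  ultimately have "?q = (\<Sum>k<p. monom 1 (p ^ i) ^ k)" by simp
  then have "poly ?q 1 = poly (\<Sum>k<p. monom 1 (p ^ i) ^ k) 1" by simp
  then show ?thesis by (simp add: poly_prod poly_sum poly_monom poly_power del: power_Suc)
qed

section \<open>Conjugate roots and cyclotomic polynomials\<close>

abbreviation cpoly :: "int poly \<Rightarrow> complex poly" where
  "cpoly \<equiv> map_poly of_int"

section \<open>Irreducibility of cyclotomic polynomials\<close>

text \<open>Gauss's lemma: contents multiply, so a primitive \<open>f\<close> leaves the scalar
  \<open>l\<close> to the cofactor, where it can be cancelled.\<close>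

lemma content_1_dvd_smultD:
  fixes f A q :: "int poly"
  assumes "smult l A = f * q" "content f = 1" "l \<noteq> 0"
  shows "f dvd A"
proof -
  have "content (smult l A) = content f * content q" unfolding assms(1) by (rule content_mult)
  then have "\<bar>l\<bar> dvd content q" using assms(2) by (intro dvdI[of _ _ "content A"]) simp
  then have "l dvd content q" by simp
  then have "[:l:] dvd q" by (simp add: const_poly_dvd_iff_dvd_content)
  then obtain q' where "q = [:l:] * q'" by blast
  then have "smult l A = smult l (f * q')" using assms(1) by simp
  then have "smult l (A - f * q') = 0" by (simp only: smult_diff_right diff_self)
  then have "A = f * q'" using assms(3) by (simp only: smult_eq_0_iff) simp
  then show ?thesis by simp
qed

text \<open>Passing to the primitive part makes the divisibility hold over the integers and not
  merely over the rationals: it removes the scalar that pseudo-division introduces.\<close>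

lemma minimal_int_poly:
  assumes "poly (cpoly P) z = 0" "P \<noteq> 0"
  obtains f where "f \<noteq> 0" "poly (cpoly f) z = 0"
    "\<forall>A. A \<noteq> 0 \<longrightarrow> poly (cpoly A) z = 0 \<longrightarrow> degree f \<le> degree A"
    "\<forall>A. poly (cpoly A) z = 0 \<longrightarrow> f dvd A"
proof -
  obtain f0 where f0: "f0 \<noteq> 0" "poly (cpoly f0) z = 0"
    and min: "\<And>A. A \<noteq> 0 \<Longrightarrow> poly (cpoly A) z = 0 \<Longrightarrow> degree f0 \<le> degree A"
    using ex_has_least_nat[of "\<lambda>A. A \<noteq> 0 \<and> poly (cpoly A) z = 0" P degree] assms by blast
  define f where "f = primitive_part f0"
  have f: "f \<noteq> 0" "content f = 1" "degree f = degree f0" using f0 by (simp_all add: f_def)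
  have "cpoly f0 = smult (of_int (content f0)) (cpoly f)"
    unfolding f_def by (metis content_times_primitive_part of_int_poly_hom.base.map_poly_hom_smult of_int_hom.map_poly_hom_smult)
  then have fz: "poly (cpoly f) z = 0" using f0 by simp
  have "f dvd A" if A: "poly (cpoly A) z = 0" for A
  proof -
    obtain q r where qr: "pseudo_divmod A f = (q, r)" by (cases "pseudo_divmod A f")
    define l where "l = lead_coeff f ^ (Suc (degree A) - degree f)"
    have 1: "smult l A = f * q + r" and 2: "r = 0 \<or> degree r < degree f"
      using pseudo_divmod[OF f(1) qr] by (simp_all add: l_def)
    have "r = smult l A - f * q" using 1 by simp
    then have "poly (cpoly r) z = 0" using A fz by (simp add: hom_distribs)
    then have "r = 0" using 2 min[of r] f(3) by fastforce
    moreover have "l \<noteq> 0" using f(1) by (simp add: l_def)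
    ultimately show ?thesis using 1 f(2) by (intro content_1_dvd_smultD[of l A f q]) auto
  qed
  then show ?thesis using that[of f] f fz min by simp
qed

lemma prime_dvd_power_add_diff:
  fixes u v :: "'a :: comm_ring_1"
  assumes "prime p"
  shows "of_nat p dvd (u + v) ^ p - (u ^ p + v ^ p)"
proof -
  have p: "p > 0" using assms by (rule prime_gt_0_nat)
  have "(u + v) ^ p = (\<Sum>k\<le>p. of_nat (p choose k) * u ^ k * v ^ (p - k))" by (rule binomial_ring)
  also have "{..p} = insert 0 (insert p {0<..<p})" using p by auto
  also have "(\<Sum>k\<in>insert 0 (insert p {0<..<p}). of_nat (p choose k) * u ^ k * v ^ (p - k)) =
     v ^ p + (u ^ p + (\<Sum>k\<in>{0<..<p}. of_nat (p choose k) * u ^ k * v ^ (p - k)))"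
    using p by simp
  finally have "(u + v) ^ p - (u ^ p + v ^ p) = (\<Sum>k\<in>{0<..<p}. of_nat (p choose k) * u ^ k * v ^ (p - k))"
    by simp
  also have "of_nat p dvd \<dots>"
  proof (intro dvd_sum)
    fix k assume "k \<in> {0<..<p}"
    then have "p dvd (p choose k)" using assms by (intro dvd_choose_prime) auto
    then obtain j where "p choose k = p * j" by blast
    then have "of_nat p dvd (of_nat (p choose k) :: 'a)" by simp
    then show "of_nat p dvd of_nat (p choose k) * u ^ k * v ^ (p - k)"
      by (intro dvd_mult2)
  qed
  finally show ?thesis .
qed

lemma prime_dvd_int_power_diff:
  fixes a :: int
  assumes "prime p"
  shows "int p dvd a ^ p - a"
proof -
  have nat: "int p dvd int n ^ p - int n" for n
  proof (induction n)
    case 0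
    then show ?case using prime_gt_0_nat[OF assms] by (simp add: power_0_left)
  next
    case (Suc n)
    have "int p dvd (int n + 1) ^ p - (int n ^ p + 1 ^ p)"
      using prime_dvd_power_add_diff[OF assms, of "int n" 1] by simp
    with Suc have "int p dvd ((int n + 1) ^ p - (int n ^ p + 1 ^ p)) + (int n ^ p - int n)" by (rule dvd_add[rotated])
    then show ?case by (simp add: algebra_simps)
  qed
  have p: "p > 0" using assms by (rule prime_gt_0_nat)
  define b where "b = nat (a mod int p)"
  have b: "[a = int b] (mod int p)" using p by (simp add: b_def cong_def)
  have "[a ^ p - a = int b ^ p - int b] (mod int p)" by (intro cong_diff cong_pow b)
  then show ?thesis using nat[of b] by (simp add: cong_dvd_iff)
qed

text \<open>Frobenius modulo \<open>p\<close>: Horner recursion reduces it to the binomial theorem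
  and to Fermat's little theorem for the coefficients.\<close>

lemma prime_dvd_power_minus_pcompose:
  fixes f :: "int poly"
  assumes "prime p"
  shows "of_nat p dvd f ^ p - pcompose f (monom 1 p)"
proof (induction f rule: pCons_induct)
  case 0
  then show ?case using prime_gt_0_nat[OF assms] by (simp add: power_0_left)
next
  case (pCons a f)
  let ?x = "[:0, 1:] :: int poly" and ?y = "monom 1 p :: int poly"
  have eq: "pCons a f = [:a:] + ?x * f" by simp
  have xp: "?x ^ p = ?y" by (simp add: monom_altdef)
  have 1: "of_nat p dvd ([:a:] + ?x * f) ^ p - ([:a:] ^ p + (?x * f) ^ p)"
    by (rule prime_dvd_power_add_diff[OF assms])
  obtain b where "a ^ p - a = int p * b" using prime_dvd_int_power_diff[OF assms, of a] by blast
  then have "[:int p:] dvd [:a ^ p - a:]" by (intro dvdI[of _ _ "[:b:]"]) simp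
  then have 2: "of_nat p dvd [:a:] ^ p - [:a:]" by (simp add: of_nat_poly poly_const_pow)
  have 3: "of_nat p dvd ?y * (f ^ p - pcompose f ?y)" using pCons.IH by (rule dvd_mult)
  have "(pCons a f) ^ p - pcompose (pCons a f) ?y =
    (([:a:] + ?x * f) ^ p - ([:a:] ^ p + (?x * f) ^ p)) + ([:a:] ^ p - [:a:]) + ?y * (f ^ p - pcompose f ?y)"
    unfolding eq[symmetric] pcompose_pCons power_mult_distrib xp by (simp add: algebra_simps)
  then show ?case using 1 2 3 by (simp only: dvd_add)
qed

text \<open>By Frobenius the minimal polynomial \<open>f\<close> of \<open>z\<close> takes at
  \<open>z ^ p\<close> a value divisible by \<open>p\<close> among the integer polynomials in
  \<open>z\<close>. As \<open>p\<close> does not divide \<open>d\<close>, the polynomial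
  \<open>x^d - 1\<close> stays separable modulo \<open>p\<close>, which forces this value to
  vanish.\<close>

lemma root_power_prime:
  assumes z: "z \<in> prim_roots d" "d > 0" and p: "prime p" "\<not> p dvd d"
    and A: "poly (cpoly A) z = 0"
  shows "poly (cpoly A) (z ^ p) = 0"
proof -
  let ?X = "monom 1 d - 1 :: int poly"
  have cX: "cpoly ?X = monom 1 d - 1" by (simp add: hom_distribs of_int_hom.map_poly_hom_monom)
  have X0: "?X \<noteq> 0"
  proof
    assume "?X = 0"
    then have "poly ?X 0 = 0" by simp
    then show False using z(2) by (simp add: poly_monom power_0_left)
  qed
  have lX: "lead_coeff ?X = 1"
    using z(2) degree_add_eq_left[of "-1" "monom 1 d :: int poly"] by (simp add: degree_monom_eq)
  have Xz: "poly (cpoly ?X) z = 0"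
    using z unfolding cX by (simp add: poly_monom prim_roots_power_eq_1)
  obtain f where f: "f \<noteq> 0" "poly (cpoly f) z = 0"
    and min': "\<forall>A. A \<noteq> 0 \<longrightarrow> poly (cpoly A) z = 0 \<longrightarrow> degree f \<le> degree A"
    and dvd': "\<forall>A. poly (cpoly A) z = 0 \<longrightarrow> f dvd A"
    by (rule minimal_int_poly[OF Xz X0])
  note min = min'[rule_format] and dvd = dvd'[rule_format]
  obtain g where g: "?X = f * g" using dvd[OF Xz] by blast
  \<comment> \<open>Hence pseudo-division by \<open>f\<close> multiplies only by a unit, which
    cannot be the source of a factor \<open>p\<close>.\<close>
  have lf: "lead_coeff f dvd 1"
    using lX unfolding g lead_coeff_mult by (intro dvdI[of _ _ "lead_coeff g"]) simp
  obtain k where k: "f ^ p - pcompose f (monom 1 p) = of_nat p * k"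
    using prime_dvd_power_minus_pcompose[OF p(1), of f] by blast
  let ?w = "z ^ p"
  have "poly (cpoly (f ^ p - pcompose f (monom 1 p))) z = poly (cpoly (of_nat p * k)) z" by (simp only: k)
  then have "poly (cpoly f) z ^ p - poly (cpoly f) ?w = of_nat p * poly (cpoly k) z"
    by (simp add: hom_distribs of_int_hom.map_poly_hom_monom poly_pcompose poly_monom)
  then have fw: "poly (cpoly f) ?w = - (of_nat p * poly (cpoly k) z)"
    using f(2) prime_gt_0_nat[OF p(1)] by (subst equation_minus_iff) (simp add: power_0_left)
  \<comment> \<open>Otherwise \<open>g\<close> vanishes at \<open>?w\<close>, and differentiating \<open>x^d - 1 = f g\<close> there writes \<open>d\<close> as \<open>p\<close> times an
    integer polynomial in \<open>z\<close>, which reduction modulo \<open>f\<close> turns into \<open>p dvd d\<close>.\<close>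
  have "poly (cpoly f) ?w = 0"
  proof (rule ccontr)
    assume nz: "poly (cpoly f) ?w \<noteq> 0"
    have wd: "?w ^ d = 1" using z by (simp add: prim_rootsD flip: power_mult)
    have "cpoly f * cpoly g = monom 1 d - 1" using arg_cong[OF g, of cpoly] by (simp add: hom_distribs of_int_hom.map_poly_hom_monom)
    then have fg: "monom 1 d - 1 = cpoly f * cpoly g" by simp
    have "poly (cpoly f) ?w * poly (cpoly g) ?w = 0"
      using arg_cong[OF fg, of "\<lambda>q. poly q ?w"] wd by (simp add: poly_monom)
    then have gw: "poly (cpoly g) ?w = 0" using nz by simp
    have "pderiv (monom 1 d - 1 :: complex poly) = monom (of_nat d) (d - 1)"
      by (simp add: pderiv_diff pderiv_monom)
    then have "monom (of_nat d) (d - 1) = cpoly f * pderiv (cpoly g) + cpoly g * pderiv (cpoly f)"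
      unfolding fg by (simp add: pderiv_mult)
    from arg_cong[OF this, of "\<lambda>q. poly q ?w"] gw
    have "of_nat d * ?w ^ (d - 1) = poly (cpoly f) ?w * poly (pderiv (cpoly g)) ?w"
      by (simp add: poly_monom)
    then have "of_nat d * (?w ^ (d - 1) * ?w) = poly (cpoly f) ?w * poly (pderiv (cpoly g)) ?w * ?w"
      by (simp only: mult.assoc[symmetric])
    also have "?w ^ (d - 1) * ?w = 1" using wd z(2) by (simp flip: power_Suc2)
    finally have d: "of_nat d = - (of_nat p * poly (cpoly k) z) * poly (pderiv (cpoly g)) ?w * ?w"
      unfolding fw by simp
    define H where "H = - k * pcompose (pderiv g) (monom 1 p) * monom 1 p"
    have "poly (cpoly H) z = - poly (cpoly k) z * poly (pderiv (cpoly g)) ?w * ?w"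
      unfolding H_def by (simp add: hom_distribs of_int_hom.map_poly_hom_monom poly_pcompose poly_monom)
    with d have H: "of_nat p * poly (cpoly H) z = of_nat d" by simp
    obtain q r where qr: "pseudo_divmod H f = (q, r)" by (cases "pseudo_divmod H f")
    define l where "l = lead_coeff f ^ (Suc (degree H) - degree f)"
    have 1: "smult l H = f * q + r" and 2: "r = 0 \<or> degree r < degree f"
      using pseudo_divmod[OF f(1) qr] by (simp_all add: l_def)
    have l: "l dvd 1" unfolding l_def using lf by (metis dvd_power_same power_one)
    have "r = smult l H - f * q" using 1 by simp
    then have rz: "poly (cpoly r) z = of_int l * poly (cpoly H) z" using f(2) by (simp add: hom_distribs)
    define s where "s = smult (int p) r - [:l * int d:]"
    have "poly (cpoly s) z = 0" unfolding s_def using rz H by (simp add: hom_distribs)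
    moreover have "degree f > 0"
    proof (rule ccontr)
      assume "\<not> degree f > 0"
      then obtain a where "f = [:a:]" using degree_eq_zeroE by blast
      then show False using f by (simp add: hom_distribs)
    qed
    then have "degree s < degree f" unfolding s_def using 2 
      by (intro degree_diff_less) (auto intro: le_less_trans[OF degree_smult_le])
    ultimately have "s = 0" using min[of s] by fastforce
    then have "coeff s 0 = 0" by simp
    then have "int p dvd l * int d" unfolding s_def by (intro dvdI[of _ _ "coeff r 0"]) simp
    then have "int p dvd int d" using l by (metis dvd_mult_unit_iff')
    then show False using p(2) by simp
  qed
  moreover obtain A' where "A = f * A'" using dvd[OF A] by blast
  ultimately show ?thesis by (simp add: hom_distribs)
qed

text \<open>The primes of \<open>k\<close> are applied one at a time; each intermediate power of
  \<open>z\<close> is again primitive of order \<open>d\<close>.\<close>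

lemma root_power_coprime:
  assumes "z \<in> prim_roots d" "d > 0" "coprime k d" "poly (cpoly A) z = 0" "k > 0"
  shows "poly (cpoly A) (z ^ k) = 0"
  using assms(3,5)
proof (induction k rule: less_induct)
  case (less k)
  show ?case
  proof (cases "k = 1")
    case False
    then obtain p where p: "prime p" "p dvd k" using prime_factor_nat by blast
    then obtain j where j: "k = p * j" by blast
    have pd: "\<not> p dvd d"
      using p(1) coprime_common_divisor_nat[OF less.prems(1) p(2)] by auto
    have cj: "coprime j d" "j > 0" "j < k" using less.prems j prime_gt_1_nat[OF p(1)] by auto
    then have "poly (cpoly A) ((z ^ j) ^ p) = 0"
      using less.IH[of j] by (intro root_power_prime[OF prim_roots_power[OF assms(1) cj(1)] assms(2) p(1) pd]) auto
    then show ?thesis by (simp add: j mult.commute flip: power_mult)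
  qed (use assms in auto)
qed

lemma conjugate_root:
  assumes "z \<in> prim_roots d" "w \<in> prim_roots d" "d > 0" "poly (cpoly A) z = 0"
  shows "poly (cpoly A) w = 0"
  using prim_roots_eq_powers[OF assms(1-3)] root_power_coprime[OF assms(1,3) _ assms(4)] by metis

text \<open>Division by a monic polynomial stays within the integers, and uniqueness of the quotient
  over the complex numbers identifies it with \<open>Q\<close>.\<close>

lemma monic_quotient_int:
  assumes "cpoly G * Q = cpoly A" "lead_coeff G = 1"
  obtains q where "Q = cpoly q"
proof -
  have G: "G \<noteq> 0" using assms(2) by auto
  obtain q r where qr: "pseudo_divmod A G = (q, r)" by (cases "pseudo_divmod A G")
  have 1: "A = G * q + r" and 2: "r = 0 \<or> degree r < degree G"
    using pseudo_divmod[OF G qr] assms(2) by simp_all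
  have eq: "cpoly G * (Q - cpoly q) = cpoly r"
    using assms(1) unfolding 1 by (simp add: hom_distribs algebra_simps)
  have "Q - cpoly q = 0"
  proof (rule ccontr)
    assume nz: "Q - cpoly q \<noteq> 0"
    then have "degree (cpoly r) = degree (cpoly G) + degree (Q - cpoly q)"
      unfolding eq[symmetric] using G by (intro degree_mult_eq) auto
    then have "degree r \<ge> degree G" by simp
    moreover have "r \<noteq> 0" using eq nz G by auto
    ultimately show False using 2 by simp
  qed
  then show ?thesis using that by simp
qed

definition cyclotomic :: "nat \<Rightarrow> complex poly" where
  "cyclotomic n = (\<Prod>z\<in>prim_roots n. [:-z, 1:])"

lemma unity_poly_eq_prod_cyclotomic:
  assumes "n > 0"
  shows "monom 1 n - 1 = (\<Prod>d | d dvd n. cyclotomic d)"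
proof -
  have "{z::complex. z ^ n = 1} = (\<Union>d\<in>{d. d dvd n}. prim_roots d)"
  proof (intro equalityI subsetI)
    fix z :: complex assume "z \<in> {z. z ^ n = 1}"
    then obtain d where "d dvd n" "z \<in> prim_roots d" using root_of_unity_primitive[of z n] assms by auto
    then show "z \<in> (\<Union>d\<in>{d. d dvd n}. prim_roots d)" by auto
  qed (auto simp: prim_rootsD)
  then have "monom 1 n - 1 = (\<Prod>z\<in>(\<Union>d\<in>{d. d dvd n}. prim_roots d). [:-z, 1:])"
    by (simp only: unity_poly_eq_prod[OF assms])
  also have "\<dots> = (\<Prod>d | d dvd n. cyclotomic d)"
    unfolding cyclotomic_def using assms prim_roots_unique
    by (intro prod.UNION_disjoint ballI finite_prim_roots) (auto intro: dvd_pos_nat)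
  finally show ?thesis .
qed

text \<open>Strong induction: \<open>x^n - 1\<close> is divided by the monic integer product over
  the proper divisors of \<open>n\<close>.\<close>

lemma cyclotomic_int:
  assumes "n > 0"
  obtains F where "cpoly F = cyclotomic n" "lead_coeff F = 1"
proof -
  have "\<exists>F. cpoly F = cyclotomic n \<and> lead_coeff F = 1"
    using assms
  proof (induction n rule: less_induct)
    case (less n)
    let ?D = "{d. d dvd n} - {n}"
    have fin: "finite ?D" using less.prems by auto
    have "\<exists>F. cpoly F = cyclotomic d \<and> lead_coeff F = 1" if "d \<in> ?D" for d
      using that less.prems by (intro less.IH) (auto dest: dvd_imp_le intro: dvd_pos_nat le_neq_implies_less)
    then obtain F where F: "\<And>d. d \<in> ?D \<Longrightarrow> cpoly (F d) = cyclotomic d \<and> lead_coeff (F d) = 1" by metis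
    define G where "G = (\<Prod>d\<in>?D. F d)"
    have lG: "lead_coeff G = 1" unfolding G_def lead_coeff_prod using F by (intro prod.neutral) auto
    have "cpoly G = (\<Prod>d\<in>?D. cyclotomic d)" unfolding G_def using F by (simp add: hom_distribs)
    then have "cpoly G * cyclotomic n = monom 1 n - 1"
      using prod.remove[of "{d. d dvd n}" n cyclotomic] less.prems
      by (simp add: unity_poly_eq_prod_cyclotomic mult.commute)
    also have "\<dots> = cpoly (monom 1 n - 1)" by (simp add: hom_distribs of_int_hom.map_poly_hom_monom)
    finally obtain q where q: "cyclotomic n = cpoly q" using monic_quotient_int lG by metis
    have "lead_coeff (cyclotomic n) = 1"
      unfolding cyclotomic_def by (intro lead_coeff_prod_linear finite_prim_roots less.prems)
    then have "lead_coeff q = 1" unfolding q by simp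
    with q show ?case by metis
  qed
  then show ?thesis using that by blast
qed

section \<open>Resultants and coefficient norms\<close>

text \<open>A kernel vector would be the coefficient vector of a polynomial of degree below
  \<open>r\<close> with the \<open>r\<close> distinct roots \<open>h k\<close>.\<close>

lemma vandermonde_det_nonzero:
  fixes h :: "nat \<Rightarrow> 'a :: field"
  assumes "inj_on h {..<r}"
  shows "det (mat r r (\<lambda>(k, j). h k ^ j)) \<noteq> 0"
proof
  let ?V = "mat r r (\<lambda>(k, j). h k ^ j)"
  assume "det ?V = 0"
  then obtain v where v: "v \<in> carrier_vec r" "v \<noteq> 0\<^sub>v r" "?V *\<^sub>v v = 0\<^sub>v r"
    using det_0_iff_vec_prod_zero_field[of ?V r] by auto
  define p where "p = (\<Sum>j<r. monom (v $ j) j)"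
  have coeff: "coeff p j = (if j < r then v $ j else 0)" for j
    unfolding p_def by (simp add: coeff_sum)
  have "poly p (h k) = 0" if "k < r" for k
  proof -
    have "0 = (?V *\<^sub>v v) $ k" using v(3) that by simp
    also have "\<dots> = (\<Sum>j<r. h k ^ j * v $ j)"
      using that v(1) by (simp add: scalar_prod_def lessThan_atLeast0)
    also have "\<dots> = poly p (h k)" unfolding p_def by (simp add: poly_sum poly_monom mult.commute)
    finally show ?thesis by simp
  qed
  then have sub: "h ` {..<r} \<subseteq> {x. poly p x = 0}" by auto
  have "p = 0"
  proof (rule ccontr)
    assume "p \<noteq> 0"
    then have "r > 0" using coeff by (metis coeff_0 not_less_zero poly_eqI gr0I)
    have "r = card (h ` {..<r})" using card_image[OF assms] by simp
    also have "\<dots> \<le> card {x. poly p x = 0}" using sub \<open>p \<noteq> 0\<close> by (intro card_mono poly_roots_finite)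
    also have "\<dots> \<le> degree p" using \<open>p \<noteq> 0\<close> by (rule poly_roots_degree)
    also have "degree p \<le> r - 1" using coeff by (intro degree_le) auto
    finally show False using \<open>r > 0\<close> by simp
  qed
  then have "v $ i = 0" if "i < r" for i using coeff[of i] that by simp
  then have "v = 0\<^sub>v r" using v(1) by (intro eq_vecI) auto
  with v(2) show False by simp
qed

text \<open>The product is the resultant of the monic \<open>F\<close> with \<open>H\<close>. Since
  \<open>Z\<close> is a set, the roots of \<open>F\<close> are simple, which is what makes the
  Vandermonde matrix invertible.\<close>

lemma resultant_int:
  assumes "cpoly F = (\<Prod>z\<in>Z. [:-z, 1:])" "finite Z"
  obtains N :: int where "(\<Prod>z\<in>Z. poly (cpoly H) z) = of_int N"
proof -
  define r where "r = card Z"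
  obtain h where h: "bij_betw h {..<r} Z" using ex_bij_betw_nat_finite[OF assms(2)] by (auto simp: r_def lessThan_atLeast0)
  have deg: "degree F = r" using degree_prod_linear[OF assms(2)] unfolding assms(1)[symmetric] by (simp add: r_def)
  have lF: "lead_coeff F = 1" using lead_coeff_prod_linear[OF assms(2)] unfolding assms(1)[symmetric] by simp
  then have F0: "F \<noteq> 0" by auto
  have Fz: "poly (cpoly F) z = 0" if "z \<in> Z" for z
    unfolding assms(1) using that assms(2) by (auto simp: poly_prod)
  have "\<exists>q R. H * monom 1 i = F * q + R \<and> (R = 0 \<or> degree R < degree F)" for i
  proof -
    obtain q R where "pseudo_divmod (H * monom 1 i) F = (q, R)" by (cases "pseudo_divmod (H * monom 1 i) F")
    from pseudo_divmod[OF F0 this] lF show ?thesis by auto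
  qed
  then obtain q R where R: "\<And>i. H * monom 1 i = F * q i + R i" "\<And>i. R i = 0 \<or> degree (R i) < degree F"
    by metis
  \<comment> \<open>The integer matrix \<open>?M\<close> of multiplication by \<open>H\<close> modulo \<open>F\<close> has the Vandermonde matrix as eigenbasis.\<close>
  let ?M = "mat r r (\<lambda>(j, i). coeff (R i) j)" and ?V = "mat r r (\<lambda>(k, j). h k ^ j)"
    and ?D = "mat r r (\<lambda>(j, k). if j = k then poly (cpoly H) (h k) else 0)"
  have "?V * map_mat of_int ?M = ?D * ?V"
  proof (rule eq_matI)
    fix k i assume "k < dim_row (?D * ?V)" "i < dim_col (?D * ?V)"
    then have ki: "k < r" "i < r" by auto
    have hk: "h k \<in> Z" using h ki by (auto simp: bij_betw_def)
    have "poly (cpoly H) (h k) * h k ^ i = poly (cpoly (H * monom 1 i)) (h k)"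
      by (simp add: hom_distribs of_int_hom.map_poly_hom_monom poly_monom)
    also have "\<dots> = poly (cpoly (R i)) (h k)"
      unfolding R(1) using Fz[OF hk] by (simp add: hom_distribs)
    also have "\<dots> = (\<Sum>j<r. of_int (coeff (R i) j) * h k ^ j)"
      unfolding poly_altdef using R(2)[of i] deg ki
      by (intro sum.mono_neutral_cong_left) (auto simp: coeff_eq_0)
    finally have eq: "poly (cpoly H) (h k) * h k ^ i = (\<Sum>j<r. of_int (coeff (R i) j) * h k ^ j)" .
    have "(?V * map_mat of_int ?M) $$ (k, i) = (\<Sum>j<r. h k ^ j * of_int (coeff (R i) j))"
      using ki by (simp add: scalar_prod_def lessThan_atLeast0)
    also have "\<dots> = poly (cpoly H) (h k) * h k ^ i" unfolding eq by (simp add: mult.commute)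
    also have "\<dots> = (\<Sum>j<r. (if k = j then poly (cpoly H) (h j) else 0) * h j ^ i)"
      using ki by (simp add: if_distrib[of "\<lambda>x. x * _"] cong: if_cong)
    also have "\<dots> = (?D * ?V) $$ (k, i)"
      using ki by (simp add: scalar_prod_def lessThan_atLeast0)
    finally show "(?V * map_mat of_int ?M) $$ (k, i) = (?D * ?V) $$ (k, i)" .
  qed auto
  then have "det (?V * map_mat of_int ?M) = det (?D * ?V)" by simp
  then have "det ?V * det (map_mat of_int ?M) = det ?D * det ?V"
    by (subst (asm) (1 2) det_mult[of _ r]) auto
  moreover have "det ?V \<noteq> 0"
    using h by (intro vandermonde_det_nonzero) (simp add: bij_betw_def)
  ultimately have "det ?D = det (map_mat of_int ?M)" by simp
  also have "\<dots> = of_int (det ?M)" by (rule of_int_hom.hom_det)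
  finally have 1: "det ?D = of_int (det ?M)" .
  have "det ?D = (\<Prod>k<r. poly (cpoly H) (h k))"
    by (subst det_upper_triangular[of _ r]) (auto simp: prod_list_diag_prod lessThan_atLeast0)
  also have "\<dots> = (\<Prod>z\<in>Z. poly (cpoly H) z)"
    by (rule prod.reindex_bij_betw[OF h])
  finally show ?thesis using that 1 by metis
qed

text \<open>A nonzero integer has absolute value at least 1. This is the source of the lower bounds
  for discriminants and for norms of cofactors.\<close>

lemma norm_resultant_ge_1:
  assumes "cpoly F = (\<Prod>z\<in>Z. [:-z, 1:])" "finite Z" "\<And>z. z \<in> Z \<Longrightarrow> poly (cpoly H) z \<noteq> 0"
  shows "(\<Prod>z\<in>Z. norm (poly (cpoly H) z)) \<ge> 1"
proof -
  obtain N where N: "(\<Prod>z\<in>Z. poly (cpoly H) z) = of_int N" using resultant_int[OF assms(1,2)] .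
  have "(\<Prod>z\<in>Z. poly (cpoly H) z) \<noteq> 0" using assms by auto
  then have "N \<noteq> 0" using N by auto
  then have "1 \<le> \<bar>N\<bar>" by simp
  then have "(1 :: real) \<le> of_int \<bar>N\<bar>" by (simp only: of_int_1_le_iff)
  also have "\<dots> = norm (\<Prod>z\<in>Z. poly (cpoly H) z)" unfolding N by simp
  finally show ?thesis by (simp add: prod_norm)
qed

section \<open>The l^1 norm and division by linear factors\<close>

text \<open>The norm is chosen because it bounds values on the unit circle and equals the value at 1
  when the coefficients are nonnegative.\<close>

definition coeff_norm :: "complex poly \<Rightarrow> real" where
  "coeff_norm p = (\<Sum>i\<le>degree p. norm (coeff p i))"

lemma norm_poly_le_coeff_norm:
  assumes "norm z = 1"
  shows "norm (poly p z) \<le> coeff_norm p"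
proof -
  have "norm (poly p z) \<le> (\<Sum>i\<le>degree p. norm (coeff p i * z ^ i))"
    unfolding poly_altdef by (rule norm_sum)
  then show ?thesis using assms by (simp add: coeff_norm_def norm_mult norm_power)
qed

text \<open>Up to powers of \<open>z\<close>, the coefficients of the quotient are partial sums of
  those of the product, so each is at most the full norm. There are \<open>degree q + 1\<close> of
  them, exactly the degree of the product.\<close>

lemma coeff_norm_synthetic_div:
  assumes "norm z = 1"
  shows "coeff_norm q \<le> real (degree ([:-z, 1:] * q)) * coeff_norm ([:-z, 1:] * q)"
proof (cases "q = 0")
  case False
  let ?p = "[:-z, 1:] * q"
  have deg: "degree ?p = Suc (degree q)" using False by (subst degree_mult_eq) auto
  have coeff: "coeff ?p i = (if i = 0 then 0 else coeff q (i - 1)) - z * coeff q i" for i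
    by (cases i) auto
  have bound: "norm (coeff q i) \<le> (\<Sum>j\<le>i. norm (coeff ?p j))" for i
  proof (induction i)
    case 0
    have "norm (coeff ?p 0) = norm (coeff q 0)" unfolding coeff using assms by (simp add: norm_mult)
    then show ?case by simp
  next
    case (Suc i)
    have "norm (coeff q (Suc i)) = norm (z * coeff q (Suc i))" using assms by (simp add: norm_mult)
    also have "z * coeff q (Suc i) = coeff q i - coeff ?p (Suc i)" unfolding coeff by simp
    also have "norm \<dots> \<le> norm (coeff q i) + norm (coeff ?p (Suc i))" by (rule norm_triangle_ineq4)
    finally show ?case using Suc by simp
  qed
  have "norm (coeff q i) \<le> coeff_norm ?p" if "i \<le> degree q" for i
    using bound[of i] that deg unfolding coeff_norm_def
    by (elim order_trans) (intro sum_mono2, auto)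
  then have "coeff_norm q \<le> (\<Sum>i\<le>degree q. coeff_norm ?p)" unfolding coeff_norm_def[of q] by (intro sum_mono) auto
  then show ?thesis unfolding deg by simp
qed (simp add: coeff_norm_def)

lemma coeff_norm_divide_power:
  assumes "norm z = 1" "[:-z, 1:] ^ j * q \<noteq> 0" "degree ([:-z, 1:] ^ j * q) \<le> n"
  shows "coeff_norm q \<le> real n ^ j * coeff_norm ([:-z, 1:] ^ j * q)"
  using assms(2,3)
proof (induction j arbitrary: q)
  case (Suc j)
  have eq: "[:-z, 1:] ^ Suc j * q = [:-z, 1:] ^ j * ([:-z, 1:] * q)" by (simp only: power_Suc mult_ac)
  have "[:-z, 1:] * q \<noteq> 0" using Suc.prems(1) unfolding eq by auto
  then have "degree ([:-z, 1:] * q) \<le> degree ([:-z, 1:] ^ j * ([:-z, 1:] * q))"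
    using Suc.prems(1) unfolding eq by (subst degree_mult_eq[of "[:-z, 1:] ^ j"]) auto
  then have deg: "degree ([:-z, 1:] * q) \<le> n" using Suc.prems(2) unfolding eq by simp
  have "coeff_norm q \<le> real (degree ([:-z, 1:] * q)) * coeff_norm ([:-z, 1:] * q)"
    by (rule coeff_norm_synthetic_div[OF assms(1)])
  also have "\<dots> \<le> real n * coeff_norm ([:-z, 1:] * q)"
    using deg by (intro mult_right_mono) (auto simp: coeff_norm_def intro!: sum_nonneg)
  also have "\<dots> \<le> real n * (real n ^ j * coeff_norm ([:-z, 1:] ^ j * ([:-z, 1:] * q)))"
    using Suc.prems unfolding eq by (intro mult_left_mono Suc.IH) auto
  finally show ?case unfolding eq by simp
qed simp

section \<open>Multiplicities of roots of unity\<close>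

lemma order_cyclotomic:
  assumes "z \<in> prim_roots d" "d > 0"
  shows "order z (cyclotomic d) = 1"
proof -
  have fin: "finite (prim_roots d)" using assms(2) by (rule finite_prim_roots)
  have eq: "cyclotomic d = [:-z, 1:] ^ 1 * (\<Prod>w\<in>prim_roots d - {z}. [:-w, 1:])"
    unfolding cyclotomic_def power_one_right by (rule prod.remove[OF fin assms(1)])
  have nz: "(\<Prod>w\<in>prim_roots d - {z}. [:-w, 1:]) \<noteq> 0" using fin by auto
  have "poly (\<Prod>w\<in>prim_roots d - {z}. [:-w, 1:]) z \<noteq> 0" using fin by (auto simp: poly_prod)
  then have "order z (\<Prod>w\<in>prim_roots d - {z}. [:-w, 1:]) = 0" by (rule order_0I)
  moreover have "order z ([:-z, 1:] ^ 1) = 1" by (rule order_power_n_n)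
  ultimately show ?thesis
    unfolding eq using nz by (subst order_mult) (simp_all del: mult_pCons_left power_one_right)
qed

text \<open>One factor \<open>cyclotomic d\<close> is removed at a time. The cofactor is again an
  integer polynomial, so its roots also come with all their conjugates.\<close>

lemma cyclotomic_power_dvd:
  assumes "z \<in> prim_roots d" "d > 0" "[:-z, 1:] ^ j dvd cpoly A"
  shows "cyclotomic d ^ j dvd cpoly A"
  using assms(3)
proof (induction j arbitrary: A)
  case (Suc j)
  show ?case
  proof (cases "A = 0")
    case False
    have fin: "finite (prim_roots d)" using assms(2) by (rule finite_prim_roots)
    have "[:-z, 1:] dvd cpoly A" using Suc.prems by (metis dvd_mult_left power_Suc)
    then have "poly (cpoly A) z = 0" by (simp only: poly_eq_0_iff_dvd)
    then have "poly (cpoly A) w = 0" if "w \<in> prim_roots d" for w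
      using conjugate_root[OF assms(1) that assms(2)] by simp
    then have "(\<Prod>w\<in>prim_roots d. [:-w, 1:] ^ 1) dvd cpoly A"
      using False fin by (intro prod_linear_dvd) (auto simp: Suc_le_eq order_gt_0_iff)
    then obtain Q where Q: "cpoly A = cyclotomic d * Q" unfolding cyclotomic_def power_one_right by (rule dvdE)
    obtain F where F: "cpoly F = cyclotomic d" "lead_coeff F = 1" using cyclotomic_int[OF assms(2)] .
    then obtain q where q: "Q = cpoly q" using monic_quotient_int[of F Q A] Q by auto
    have nz: "cyclotomic d * cpoly q \<noteq> 0" using Q q False by (metis of_int_poly_hom.hom_0_iff)
    have "Suc j \<le> order z (cyclotomic d * cpoly q)"
      using Suc.prems nz unfolding Q q by (simp only: order_divides) simp
    also have "\<dots> = 1 + order z (cpoly q)"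
      using nz order_cyclotomic[OF assms(1,2)] by (simp add: order_mult)
    finally have "[:-z, 1:] ^ j dvd cpoly q" by (simp add: order_divides)
    then have "cyclotomic d ^ j dvd cpoly q" by (rule Suc.IH)
    then show ?thesis unfolding Q q power_Suc by (intro mult_dvd_mono) auto
  qed simp
qed simp

text \<open>This is \<open>mu d\<close> of the overview. The chosen root is a mere representative:
  by \<open>order_prim_root\<close> every primitive \<open>d\<close>-th root gives the same
  value.\<close>

definition rmult :: "int poly \<Rightarrow> nat \<Rightarrow> nat" where
  "rmult A d = order (cis (2 * pi / d)) (cpoly A)"

lemma order_prim_root:
  assumes "A \<noteq> 0" "z \<in> prim_roots d" "d > 0"
  shows "order z (cpoly A) = rmult A d"
proof -
  have le: "order x (cpoly A) \<le> order y (cpoly A)"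
    if "x \<in> prim_roots d" "y \<in> prim_roots d" for x y
  proof -
    let ?j = "order x (cpoly A)"
    have "[:-y, 1:] dvd cyclotomic d"
      unfolding cyclotomic_def using that finite_prim_roots[OF assms(3)] by (intro dvd_prodI)
    then have "[:-y, 1:] ^ ?j dvd cyclotomic d ^ ?j" by (rule dvd_power_same)
    also have "\<dots> dvd cpoly A" using cyclotomic_power_dvd[OF that(1) assms(3)] order_1 by blast
    finally show ?thesis using assms(1) by (simp add: order_divides)
  qed
  show ?thesis unfolding rmult_def
    using le[OF assms(2) prim_roots_cis[OF assms(3)]] le[OF prim_roots_cis[OF assms(3)] assms(2)] by simp
qed

lemma rmult_pos_iff:
  assumes "A \<noteq> 0" "z \<in> prim_roots d" "d > 0"
  shows "rmult A d > 0 \<longleftrightarrow> poly (cpoly A) z = 0"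
  using order_prim_root[OF assms] assms(1) by (simp add: order_root)

text \<open>The cofactor \<open>H\<close> is kept integral and free of the roots concerned, so that
  its norm over each \<open>prim_roots d\<close> is at least 1.\<close>

lemma cyclotomic_factorization:
  assumes "A \<noteq> 0" "finite D" "\<And>d. d \<in> D \<Longrightarrow> d > 0"
  obtains H where "cpoly A = (\<Prod>d\<in>D. cyclotomic d ^ rmult A d) * cpoly H"
    "\<forall>d\<in>D. \<forall>z\<in>prim_roots d. poly (cpoly H) z \<noteq> 0"
proof -
  have "(\<Prod>z\<in>(\<Union>d\<in>D. prim_roots d). [:-z, 1:] ^ order z (cpoly A)) =
      (\<Prod>d\<in>D. \<Prod>z\<in>prim_roots d. [:-z, 1:] ^ order z (cpoly A))"
    using assms prim_roots_unique
    by (intro prod.UNION_disjoint ballI finite_prim_roots impI) blast+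
  also have "\<dots> = (\<Prod>d\<in>D. cyclotomic d ^ rmult A d)"
    unfolding cyclotomic_def prod_power_distrib
    by (intro prod.cong refl) (simp add: order_prim_root[OF assms(1) _ assms(3)])
  finally have eq: "(\<Prod>z\<in>(\<Union>d\<in>D. prim_roots d). [:-z, 1:] ^ order z (cpoly A)) =
    (\<Prod>d\<in>D. cyclotomic d ^ rmult A d)" .
  have "(\<Prod>z\<in>(\<Union>d\<in>D. prim_roots d). [:-z, 1:] ^ order z (cpoly A)) dvd cpoly A"
    using assms finite_prim_roots by (intro prod_linear_dvd) auto
  then obtain Q where Q: "cpoly A = (\<Prod>d\<in>D. cyclotomic d ^ rmult A d) * Q" unfolding eq by (rule dvdE)
  have "\<exists>F. cpoly F = cyclotomic d \<and> lead_coeff F = 1" if "d \<in> D" for d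
    using cyclotomic_int[OF assms(3)[OF that]] by metis
  then obtain F where F: "\<And>d. d \<in> D \<Longrightarrow> cpoly (F d) = cyclotomic d \<and> lead_coeff (F d) = 1" by metis
  define G where "G = (\<Prod>d\<in>D. F d ^ rmult A d)"
  have "lead_coeff G = 1" unfolding G_def lead_coeff_prod lead_coeff_power using F by (intro prod.neutral) auto
  moreover have "cpoly G = (\<Prod>d\<in>D. cyclotomic d ^ rmult A d)"
    unfolding G_def using F by (simp add: hom_distribs)
  ultimately obtain H where H: "Q = cpoly H" using monic_quotient_int[of G Q A] Q by metis
  have "poly (cpoly H) z \<noteq> 0" if "d \<in> D" "z \<in> prim_roots d" for d z
  proof
    assume "poly (cpoly H) z = 0"
    then have 1: "[:-z, 1:] dvd cpoly H" by (simp only: poly_eq_0_iff_dvd)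
    have "[:-z, 1:] dvd cyclotomic d"
      unfolding cyclotomic_def using that finite_prim_roots[OF assms(3)] by (intro dvd_prodI) auto
    then have "[:-z, 1:] ^ rmult A d dvd cyclotomic d ^ rmult A d" by (rule dvd_power_same)
    also have "\<dots> dvd (\<Prod>d\<in>D. cyclotomic d ^ rmult A d)" using that assms(2) by (intro dvd_prodI)
    finally have "[:-z, 1:] ^ rmult A d * [:-z, 1:] dvd cpoly A"
      unfolding Q H using 1 by (intro mult_dvd_mono)
    then have "Suc (rmult A d) \<le> order z (cpoly A)"
      using assms(1) order_divides[of z "Suc (rmult A d)" "cpoly A"] unfolding power_Suc2 by simp
    then show False using order_prim_root[OF assms(1) that(2) assms(3)[OF that(1)]] by simp
  qed
  with Q H that show ?thesis by blast
qed

section \<open>Resultants of two cyclotomic polynomials\<close>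

lemma bij_betw_power_prim_roots:
  assumes "coprime k e" "e > 0"
  shows "bij_betw (\<lambda>z. z ^ k) (prim_roots e) (prim_roots e)"
proof -
  have inj: "inj_on (\<lambda>z. z ^ k) (prim_roots e)"
  proof (rule inj_onI)
    fix x y assume *: "x \<in> prim_roots e" "y \<in> prim_roots e" "x ^ k = y ^ k"
    have y: "y \<noteq> 0" using * prim_roots_nonzero assms by blast
    have e: "(x / y) ^ e = 1" using * by (simp add: power_divide prim_roots_power_eq_1)
    have k: "(x / y) ^ k = 1" using *(3) y by (simp add: power_divide)
    obtain n where n: "n dvd e" "x / y \<in> prim_roots n" using root_of_unity_primitive[OF e assms(2)] by blast
    moreover have "n dvd k" using prim_rootsD[OF n(2), of k] k by simp
    ultimately have "n = 1" using coprime_common_divisor_nat[OF assms(1), of n] by simp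
    then show "x = y" using prim_roots_power_eq_1[OF n(2)] y by simp
  qed
  have "(\<lambda>z. z ^ k) ` prim_roots e \<subseteq> prim_roots e" using prim_roots_power[OF _ assms(1)] by auto
  then have "(\<lambda>z. z ^ k) ` prim_roots e = prim_roots e"
    by (intro endo_inj_surj finite_prim_roots assms inj)
  with inj show ?thesis by (simp add: bij_betw_def)
qed

text \<open>For \<open>k = 1\<close> this is the absolute value of the discriminant of
  \<open>cyclotomic e\<close>, each pair of roots being counted in both orders; in general the roots
  are replaced by their \<open>k\<close>-th powers.\<close>

definition prim_disc :: "nat \<Rightarrow> nat \<Rightarrow> real" where
  "prim_disc k e = (\<Prod>x\<in>prim_roots e. \<Prod>y\<in>prim_roots e - {x}. norm (x ^ k - y ^ k))"

lemma prim_disc_coprime: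
  assumes "coprime k e" "e > 0"
  shows "prim_disc k e = prim_disc 1 e"
proof -
  note bij = bij_betw_power_prim_roots[OF assms]
  have "(\<Prod>y\<in>prim_roots e - {x}. norm (x ^ k - y ^ k)) = (\<Prod>y\<in>prim_roots e - {x ^ k}. norm (x ^ k - y))"
    if "x \<in> prim_roots e" for x
  proof (rule prod.reindex_bij_betw)
    show "bij_betw (\<lambda>y. y ^ k) (prim_roots e - {x}) (prim_roots e - {x ^ k})"
      using bij that by (intro bij_betw_DiffI) (auto dest: bij_betwE)
  qed
  then have "prim_disc k e = (\<Prod>x\<in>prim_roots e. \<Prod>y\<in>prim_roots e - {x ^ k}. norm (x ^ k - y))"
    unfolding prim_disc_def by (rule prod.cong[OF refl])
  also have "\<dots> = (\<Prod>x\<in>prim_roots e. \<Prod>y\<in>prim_roots e - {x}. norm (x - y))"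
    by (rule prod.reindex_bij_betw[OF bij])
  finally show ?thesis by (simp add: prim_disc_def)
qed

text \<open>The discriminant is the resultant with the derivative, whose value at a root is the
  product of the differences to the other roots.\<close>

lemma prim_disc_ge_1:
  assumes "e > 0"
  shows "prim_disc 1 e \<ge> 1"
proof -
  have fin: "finite (prim_roots e)" using assms by (rule finite_prim_roots)
  obtain F where F: "cpoly F = cyclotomic e" using cyclotomic_int[OF assms] .
  have eq: "poly (cpoly (pderiv F)) x = (\<Prod>y\<in>prim_roots e - {x}. x - y)" if "x \<in> prim_roots e" for x
  proof -
    have "cyclotomic e = [:-x, 1:] * (\<Prod>y\<in>prim_roots e - {x}. [:-y, 1:])"
      unfolding cyclotomic_def by (rule prod.remove[OF fin that])
    then have "pderiv (cyclotomic e) = [:-x, 1:] * pderiv (\<Prod>y\<in>prim_roots e - {x}. [:-y, 1:]) +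
      (\<Prod>y\<in>prim_roots e - {x}. [:-y, 1:]) * pderiv [:-x, 1:]" by (simp only: pderiv_mult)
    then have "poly (pderiv (cyclotomic e)) x = (\<Prod>y\<in>prim_roots e - {x}. x - y)"
      by (simp add: poly_prod pderiv_pCons)
    then show ?thesis by (simp add: hom_distribs F)
  qed
  have "1 \<le> (\<Prod>x\<in>prim_roots e. norm (poly (cpoly (pderiv F)) x))"
    using F fin by (intro norm_resultant_ge_1[of F]) (auto simp: cyclotomic_def eq)
  also have "\<dots> = prim_disc 1 e" unfolding prim_disc_def by (intro prod.cong refl) (simp add: eq prod_norm)
  finally show ?thesis .
qed

text \<open>The roots of \<open>cyclotomic (e * p ^ Suc i)\<close> are the products
  \<open>y * w\<close> with \<open>y\<close> of order \<open>e\<close> and \<open>w\<close> of order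
  \<open>p ^ Suc i\<close>. The diagonal terms \<open>y = x\<close> contribute the value
  \<open>p\<close> of a prime power cyclotomic polynomial at 1, one for each of the
  \<open>totient e\<close> roots \<open>x\<close>; the other terms multiply to 1.\<close>

lemma norm_cyclotomic_prime_power:
  assumes "prime p" "\<not> p dvd e" "e > 0"
  shows "(\<Prod>x\<in>prim_roots e. norm (poly (cyclotomic (e * p ^ Suc i)) x)) = real p ^ totient e"
proof -
  let ?E = "prim_roots e" and ?P = "prim_roots (p ^ Suc i)"
  define f where "f x y = norm (\<Prod>w\<in>?P. x - y * w)" for x y
  have p: "p > 0" using assms(1) by (rule prime_gt_0_nat)
  have fin: "finite ?E" using assms(3) by (rule finite_prim_roots)
  have cop: "coprime (p ^ k) e" for k using assms(1,2) by (simp add: prime_imp_coprime)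
  have cop': "coprime e (p ^ Suc i)" using cop[of "Suc i"] by (simp only: coprime_commute)
  have "norm (poly (cyclotomic (e * p ^ Suc i)) x) = (\<Prod>y\<in>?E. f x y)" for x
  proof -
    have "(\<Prod>z\<in>prim_roots (e * p ^ Suc i). x - z) = (\<Prod>(y, w)\<in>?E \<times> ?P. x - y * w)"
      using p prod.reindex_bij_betw[OF bij_betw_prim_roots_mult[OF cop' assms(3)], of "\<lambda>z. x - z"]
      by (simp add: case_prod_unfold)
    also have "\<dots> = (\<Prod>y\<in>?E. \<Prod>w\<in>?P. x - y * w)" by (rule prod.cartesian_product[symmetric])
    finally show ?thesis by (simp add: cyclotomic_def poly_prod f_def prod_norm)
  qed
  then have "(\<Prod>x\<in>?E. norm (poly (cyclotomic (e * p ^ Suc i)) x)) = (\<Prod>x\<in>?E. \<Prod>y\<in>?E. f x y)" by simp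
  also have "\<dots> = (\<Prod>x\<in>?E. f x x * (\<Prod>y\<in>?E - {x}. f x y))"
    using fin by (intro prod.cong refl prod.remove)
  also have "\<dots> = (\<Prod>x\<in>?E. f x x) * (\<Prod>x\<in>?E. \<Prod>y\<in>?E - {x}. f x y)" by (rule prod.distrib)
  also have "(\<Prod>x\<in>?E. f x x) = (\<Prod>x\<in>?E. real p)"
  proof (intro prod.cong refl)
    fix x assume x: "x \<in> ?E"
    have "(\<Prod>w\<in>?P. x - x * w) = (\<Prod>w\<in>?P. x) * (\<Prod>w\<in>?P. 1 - w)"
      unfolding prod.distrib[symmetric] by (intro prod.cong refl) (simp add: algebra_simps)
    then show "f x x = real p" unfolding f_def prod_one_minus_prim_roots_prime_power[OF assms(1)]
      using prim_roots_norm[OF x assms(3)] by (simp add: norm_mult norm_power)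
  qed
  also have "\<dots> = real p ^ totient e" using card_prim_roots[OF assms(3)] by simp
  also have "(\<Prod>x\<in>?E. \<Prod>y\<in>?E - {x}. f x y) = 1"
  \<comment> \<open>It is a quotient of two discriminants, which agree because \<open>p\<close>-th powers permute \<open>?E\<close>.\<close>
  proof -
    have "f x y * norm (x ^ p ^ i - y ^ p ^ i) = norm (x ^ p ^ Suc i - y ^ p ^ Suc i)" for x y
      unfolding f_def norm_mult[symmetric] prod_prim_roots_prime_power[OF assms(1)] ..
    then have "prim_disc (p ^ Suc i) e =
      (\<Prod>x\<in>?E. \<Prod>y\<in>?E - {x}. f x y * norm (x ^ p ^ i - y ^ p ^ i))"
      unfolding prim_disc_def by simp
    also have "\<dots> = (\<Prod>x\<in>?E. \<Prod>y\<in>?E - {x}. f x y) * prim_disc (p ^ i) e"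
      unfolding prim_disc_def by (simp only: prod.distrib)
    finally show ?thesis
      using prim_disc_ge_1[OF assms(3)] unfolding prim_disc_coprime[OF cop assms(3)] by simp
  qed
  finally show ?thesis by simp
qed

text \<open>The product of \<open>N x\<close> over the primitive \<open>e\<close>-th roots is
  estimated twice. From below, the discriminant and the norm of \<open>H\<close> are at least 1,
  which leaves the resultants; from above, each \<open>N x\<close> is bounded separately. A
  \<open>totient e\<close>-th root finishes.\<close>

theorem prod_prime_power_rmult_le:
  assumes A: "A \<noteq> 0" "degree A \<le> n" and e: "e > 0" and Q: "finite Q"
    "\<And>p i. (p, i) \<in> Q \<Longrightarrow> prime p \<and> \<not> p dvd e"
  shows "(\<Prod>(p, i)\<in>Q. real p ^ rmult A (e * p ^ Suc i)) \<le> coeff_norm (cpoly A) * real n ^ rmult A e"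
proof -
  let ?E = "prim_roots e"
  define d where "d = (\<lambda>(p :: nat, i). e * p ^ Suc i)"
  define j where "j = rmult A e"
  define M where "M = coeff_norm (cpoly A)"
  have fin: "finite ?E" using e by (rule finite_prim_roots)
  have inj: "inj_on d Q"
  proof (rule inj_onI, clarify)
    fix p i p' i' assume 1: "(p, i) \<in> Q" "(p', i') \<in> Q" "d (p, i) = d (p', i')"
    then have eq: "p ^ Suc i = p' ^ Suc i'" using e unfolding d_def prod.case by simp
    have "p = p'" "Suc i = Suc i'"
      using prime_power_inj''[of p p' "Suc i" "Suc i'"] eq Q(2)[OF 1(1)] Q(2)[OF 1(2)] by auto
    then show "p = p' \<and> i = i'" by simp
  qed
  have enot: "e \<notin> d ` Q"
  proof
    assume "e \<in> d ` Q"
    then obtain p i where "(p, i) \<in> Q" "e = e * p ^ Suc i" by (auto simp: d_def)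
    then have "p ^ Suc i = 1" "prime p" using e Q(2) by auto
    then show False by (simp add: prime_gt_1_nat)
  qed
  have dpos: "x > 0" if x: "x \<in> insert e (d ` Q)" for x
  proof (cases "x = e")
    case False
    then obtain p i where "(p, i) \<in> Q" "x = e * p ^ Suc i" using x by (auto simp: d_def)
    then show ?thesis using e Q(2)[of p i] by (simp add: prime_gt_0_nat)
  qed (use e in simp)
  obtain H where H: "cpoly A = (\<Prod>x\<in>insert e (d ` Q). cyclotomic x ^ rmult A x) * cpoly H"
    and nz: "\<forall>x\<in>insert e (d ` Q). \<forall>z\<in>prim_roots x. poly (cpoly H) z \<noteq> 0"
    using cyclotomic_factorization[OF A(1) _ dpos, of "insert e (d ` Q)"] Q(1) by auto
  have H': "cpoly A = cyclotomic e ^ j * ((\<Prod>q\<in>Q. cyclotomic (d q) ^ rmult A (d q)) * cpoly H)"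
    using H Q(1) enot by (simp add: prod.reindex[OF inj] j_def mult.assoc)
  \<comment> \<open>\<open>N x\<close> is the absolute value at \<open>x\<close> of \<open>A\<close>
    divided by \<open>[:-x, 1:] ^ j\<close> alone. The other linear factors of
    \<open>cyclotomic e\<close> stay and form a discriminant; dividing them out as well would raise
    the exponent of \<open>n\<close> from \<open>j\<close> to \<open>j * totient e\<close>.\<close>
  define N where "N x = (\<Prod>y\<in>?E - {x}. norm (x - y)) ^ j *
    ((\<Prod>q\<in>Q. norm (poly (cyclotomic (d q)) x) ^ rmult A (d q)) * norm (poly (cpoly H) x))" for x
  have bound: "N x \<le> real n ^ j * M" if x: "x \<in> ?E" for x
  proof -
    define K where "K = (\<Prod>y\<in>?E - {x}. [:-y, 1:]) ^ j * ((\<Prod>q\<in>Q. cyclotomic (d q) ^ rmult A (d q)) * cpoly H)"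
    have "cyclotomic e = [:-x, 1:] * (\<Prod>y\<in>?E - {x}. [:-y, 1:])"
      unfolding cyclotomic_def by (rule prod.remove[OF fin x])
    then have AK: "cpoly A = [:-x, 1:] ^ j * K"
      unfolding H' K_def by (simp only: power_mult_distrib mult.assoc)
    have nx: "norm x = 1" using x e by (rule prim_roots_norm)
    have "norm (poly K x) = N x"
      unfolding K_def N_def by (simp add: poly_prod norm_mult norm_power prod_norm[symmetric])
    then have "N x \<le> coeff_norm K" using norm_poly_le_coeff_norm[OF nx, of K] by simp
    also have "\<dots> \<le> real n ^ j * M" unfolding M_def AK
    proof (rule coeff_norm_divide_power[OF nx])
      show "[:-x, 1:] ^ j * K \<noteq> 0" using A(1) unfolding AK[symmetric] by simp
      show "degree ([:-x, 1:] ^ j * K) \<le> n" using A(2) unfolding AK[symmetric] by simp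
    qed
    finally show ?thesis .
  qed
  let ?R = "\<Prod>(p, i)\<in>Q. real p ^ rmult A (e * p ^ Suc i)"
  have "?R ^ totient e = (\<Prod>q\<in>Q. (\<Prod>x\<in>?E. norm (poly (cyclotomic (d q)) x)) ^ rmult A (d q))"
    unfolding prod_power_distrib
  proof (intro prod.cong refl, clarify)
    fix p i assume "(p, i) \<in> Q"
    then show "(real p ^ rmult A (e * p ^ Suc i)) ^ totient e =
       (\<Prod>x\<in>?E. norm (poly (cyclotomic (d (p, i))) x) ^ rmult A (d (p, i)))"
      unfolding d_def prod.case prod_power_distrib[symmetric]
      using norm_cyclotomic_prime_power[of p e i] Q(2) e by (simp add: mult.commute flip: power_mult)
  qed
  also have "\<dots> \<le> prim_disc 1 e ^ j *
      ((\<Prod>q\<in>Q. (\<Prod>x\<in>?E. norm (poly (cyclotomic (d q)) x)) ^ rmult A (d q)) * (\<Prod>x\<in>?E. norm (poly (cpoly H) x)))"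
    (is "?S \<le> _ * (_ * ?T)")
  proof -
    obtain F where "cpoly F = cyclotomic e" using cyclotomic_int[OF e] .
    then have T: "1 \<le> ?T" using fin nz by (intro norm_resultant_ge_1) (auto simp: cyclotomic_def)
    have S: "?S \<ge> 0" by (intro prod_nonneg zero_le_power) auto
    have "?S = 1 * (?S * 1)" by simp
    also have "\<dots> \<le> prim_disc 1 e ^ j * (?S * ?T)"
      using T S prim_disc_ge_1[OF e] by (intro mult_mono one_le_power mult_nonneg_nonneg) auto
    finally show ?thesis .
  qed
  also have "\<dots> = (\<Prod>x\<in>?E. N x)"
    unfolding N_def prod.distrib prim_disc_def prod_power_distrib power_one_right
    by (subst prod.swap) simp
  also have "\<dots> \<le> (\<Prod>x\<in>?E. real n ^ j * M)"
    using bound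
    by (intro prod_mono conjI) (auto simp: N_def intro!: mult_nonneg_nonneg prod_nonneg zero_le_power)
  also have "\<dots> = (real n ^ j * M) ^ totient e" using card_prim_roots[OF e] by simp
  finally have "?R ^ totient e \<le> (real n ^ j * M) ^ totient e" .
  moreover have "M \<ge> 0" unfolding M_def coeff_norm_def by (intro sum_nonneg) auto
  ultimately have "?R \<le> real n ^ j * M"
    using e power_le_imp_le_base[of ?R "totient e - 1" "real n ^ j * M"] by simp
  then show ?thesis unfolding M_def j_def by (simp add: mult.commute)
qed

section \<open>Weights summed over numbers with a given number of prime factors\<close>

text \<open>In increasing order the i-th element is at least i + 1, so the ratios x / (x - 1) are
  bounded by (i + 1) / i, and these telescope.\<close>

lemma prod_le_Suc_card_mult_prod_pred:
  assumes "finite S" "\<And>x::nat. x \<in> S \<Longrightarrow> x \<ge> 2"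
  shows "\<Prod>S \<le> Suc (card S) * (\<Prod>x\<in>S. x - 1)"
  using assms
proof (induction S rule: finite_linorder_max_induct)
  case (insert b A)
  have "A \<subseteq> {2..<b}" using insert by auto
  then have "card A \<le> card {2..<b}" by (intro card_mono) auto
  moreover have "b \<ge> 2" using insert by auto
  ultimately have b: "card A + 2 \<le> b" by simp
  then obtain t where t: "b = card A + 2 + t" using le_Suc_ex by blast
  have "b \<notin> A" using insert by auto
  then have "\<Prod>(insert b A) = b * \<Prod>A" using insert by simp
  also have "\<dots> \<le> b * (Suc (card A) * (\<Prod>x\<in>A. x - 1))" using insert by (intro mult_le_mono2) auto
  also have "\<dots> = (b * Suc (card A)) * (\<Prod>x\<in>A. x - 1)" by (simp only: mult.assoc)
  also have "b * Suc (card A) \<le> Suc (Suc (card A)) * (b - 1)" unfolding t by (simp add: algebra_simps)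
  finally have "\<Prod>(insert b A) \<le> Suc (Suc (card A)) * (b - 1) * (\<Prod>x\<in>A. x - 1)"
    by (simp only: mult_le_mono1)
  moreover have "(\<Prod>x\<in>insert b A. x - 1) = (b - 1) * (\<Prod>x\<in>A. x - 1)" "card (insert b A) = Suc (card A)"
    using insert \<open>b \<notin> A\<close> by simp_all
  ultimately show ?case by (simp only: mult.assoc)
qed simp

lemma fact_card_le_prod:
  assumes "finite S" "\<And>x::nat. x \<in> S \<Longrightarrow> x \<ge> 1"
  shows "fact (card S) \<le> \<Prod>S"
  using assms
proof (induction S rule: finite_linorder_max_induct)
  case (insert b A)
  have "A \<subseteq> {1..<b}" using insert by auto
  then have "card A \<le> card {1..<b}" by (intro card_mono) auto
  moreover have "b \<ge> 1" using insert by auto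
  ultimately have b: "Suc (card A) \<le> b" by simp
  have "b \<notin> A" using insert by auto
  then have "fact (card (insert b A)) = Suc (card A) * fact (card A)" using insert by simp
  also have "\<dots> \<le> b * \<Prod>A" using insert b by (intro mult_le_mono) auto
  finally show ?case using insert \<open>b \<notin> A\<close> by simp
qed simp

abbreviation omega :: "nat \<Rightarrow> nat" where
  "omega e \<equiv> card (prime_factors e)"

lemma prod_prime_factors_dvd: "e > 0 \<Longrightarrow> \<Prod>(prime_factors e) dvd (e :: nat)"
proof -
  assume e: "e > 0"
  have "\<Prod>(prime_factors e) dvd (\<Prod>p\<in>prime_factors e. p ^ multiplicity p e)"
    by (intro prod_dvd_prod) (auto simp: prime_factors_multiplicity intro!: dvd_power)
  then show ?thesis using e prime_factorization_nat[of e] by simp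
qed

lemma two_power_omega_le: "e > 0 \<Longrightarrow> 2 ^ omega e \<le> e"
proof -
  assume e: "e > 0"
  have "2 ^ omega e = (\<Prod>p\<in>prime_factors e. 2 :: nat)" by simp
  also have "\<dots> \<le> \<Prod>(prime_factors e)" by (intro prod_mono) (auto intro: prime_ge_2_nat)
  also have "\<dots> \<le> e" using prod_prime_factors_dvd[OF e] e by (rule dvd_imp_le)
  finally show ?thesis .
qed

lemma fact_omega_le: "e > 0 \<Longrightarrow> fact (omega e) \<le> e"
proof -
  assume e: "e > 0"
  have "fact (omega e) \<le> \<Prod>(prime_factors e)" by (intro fact_card_le_prod) (auto dest!: in_prime_factors_imp_prime prime_ge_1_nat)
  also have "\<dots> \<le> e" using prod_prime_factors_dvd[OF e] e by (rule dvd_imp_le)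
  finally show ?thesis .
qed

text \<open>The ratio of \<open>e\<close> to \<open>totient e\<close> is the product of p / (p - 1)
  over its primes, which are distinct integers from 2 on.\<close>

lemma le_totient_mult_omega:
  assumes "e > 0"
  shows "e \<le> totient e * Suc (omega e)"
proof -
  let ?P = "prime_factors e" and ?R = "\<Prod>p\<in>prime_factors e. p ^ (multiplicity p e - 1)"
  have "e = (\<Prod>p\<in>?P. p ^ multiplicity p e)" using assms by (rule prime_factorization_nat)
  also have "\<dots> = (\<Prod>p\<in>?P. p ^ (multiplicity p e - 1) * p)"
  proof (intro prod.cong refl)
    fix p assume "p \<in> ?P"
    then have "multiplicity p e > 0" by (simp add: prime_factors_multiplicity)
    then show "p ^ multiplicity p e = p ^ (multiplicity p e - 1) * p"
      by (cases "multiplicity p e") auto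
  qed
  also have "\<dots> = ?R * \<Prod>?P" by (rule prod.distrib)
  also have "\<dots> \<le> ?R * (Suc (omega e) * (\<Prod>p\<in>?P. p - 1))"
    by (intro mult_le_mono2 prod_le_Suc_card_mult_prod_pred) (auto intro: prime_ge_2_nat)
  also have "\<dots> = totient e * Suc (omega e)"
    unfolding totient_formula1[OF assms] prod.distrib by (simp only: mult_ac)
  finally show ?thesis .
qed

lemma Suc_square_le_power: "Suc k ^ 2 \<le> 4 * 2 ^ k"
proof (cases "k < 3")
  case True
  then have "k \<in> {0, 1, 2}" by auto
  then show ?thesis by (auto simp: power2_eq_square)
next
  case False
  then have "k \<ge> 3" by simp
  then show ?thesis
  proof (induction k rule: dec_induct)
    case (step k)
    have "3 * 3 \<le> k * k" using step by (intro mult_le_mono) auto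
    then have "Suc (Suc k) ^ 2 \<le> 2 * Suc k ^ 2" using step by (simp add: power2_eq_square)
    also have "\<dots> \<le> 2 * (4 * 2 ^ k)" using step by (intro mult_le_mono2)
    finally show ?case by simp
  qed simp
qed

text \<open>After squaring, the factor \<open>Suc (omega e) ^ 2\<close> is at most
  \<open>4 * 2 ^ omega e\<close>, hence at most \<open>4 * e\<close>, and one \<open>e\<close>
  cancels. This crude bound keeps logarithms of the orders within a constant times log n.\<close>

lemma le_four_totient_square:
  assumes "e > 0"
  shows "e \<le> 4 * totient e ^ 2"
proof -
  have "e * e \<le> totient e ^ 2 * Suc (omega e) ^ 2"
    using le_totient_mult_omega[OF assms] by (metis mult_le_mono power2_eq_square power_mult_distrib)
  also have "\<dots> \<le> totient e ^ 2 * (4 * 2 ^ omega e)" by (intro mult_le_mono2 Suc_square_le_power)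
  also have "\<dots> \<le> totient e ^ 2 * (4 * e)" using two_power_omega_le[OF assms] by simp
  finally have "e * e \<le> (4 * totient e ^ 2) * e" by (simp only: mult_ac)
  then show ?thesis using assms mult_le_cancel2[of e e "4 * totient e ^ 2"] by blast
qed


text \<open>The weights \<open>\<mu> e\<close> stand for the multiplicities of the primitive \<open>e\<close>-th roots of unity as roots of
  a polynomial.\<close>

definition omega_sum :: "(nat \<Rightarrow> nat) \<Rightarrow> nat set \<Rightarrow> nat \<Rightarrow> real" where
  "omega_sum \<mu> E k = (\<Sum>e | e \<in> E \<and> omega e = k. real (\<mu> e))"

section \<open>Double counting of numbers and their prime factors\<close>

lemma prime_factors_mult_prime_power:
  assumes "prime p" "\<not> p dvd f" "f > 0"
  shows "prime_factors (f * p ^ Suc i) = insert p (prime_factors f)"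
    "omega (f * p ^ Suc i) = Suc (omega f)"
proof -
  have "prime_factors (f * p ^ Suc i) = prime_factors f \<union> prime_factors (p ^ Suc i)"
    using assms by (intro prime_factors_product) (auto simp: prime_gt_0_nat)
  also have "prime_factors (p ^ Suc i) = {p}"
    using assms(1) by (subst prime_factors_power) (auto simp: prime_prime_factors)
  finally show *: "prime_factors (f * p ^ Suc i) = insert p (prime_factors f)" by simp
  show "omega (f * p ^ Suc i) = Suc (omega f)" unfolding * using assms(2) by (subst card_insert_disjoint) auto
qed

lemma prime_power_split:
  assumes "prime p" "p dvd e" "e > (0::nat)"
  obtains f i where "e = f * p ^ Suc i" "\<not> p dvd f" "f > 0"
proof -
  have "e \<noteq> 0" "\<not> is_unit p" using assms by auto
  then obtain f where f: "e = p ^ multiplicity p e * f" "\<not> p dvd f" by (rule multiplicity_decompose')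
  moreover have "multiplicity p e > 0" using assms by (simp add: prime_multiplicity_gt_zero_iff)
  ultimately show ?thesis using that[of f "multiplicity p e - 1"] assms(3)
    by (metis Suc_pred' mult.commute gr0I mult_zero_left)
qed

lemma multiplicity_mult_prime_power:
  assumes "prime p" "\<not> p dvd f"
  shows "multiplicity p (f * p ^ k) = (k :: nat)"
proof -
  have "f \<noteq> 0" using assms(2) by auto
  then show ?thesis using assms
    by (subst prime_elem_multiplicity_mult_distrib) (auto simp: not_dvd_imp_multiplicity_0)
qed

text \<open>The pairs of a number and one of its primes are counted twice: each number with
  \<open>Suc k\<close> primes occurs \<open>Suc k\<close> times, which builds up the factorial,
  while grouping by the part prime to \<open>p\<close> makes \<open>key\<close> applicable.\<close>

lemma omega_sum_step:
  fixes c L :: real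
  assumes E: "finite E" "\<And>e. e \<in> E \<Longrightarrow> e > 0" "\<And>e f. e \<in> E \<Longrightarrow> f dvd e \<Longrightarrow> f \<in> E"
    and key: "\<And>e Q. e > 0 \<Longrightarrow> finite Q \<Longrightarrow> (\<And>p i. (p, i) \<in> Q \<Longrightarrow> prime p \<and> \<not> p dvd e) \<Longrightarrow>
      (\<Sum>(p, i)\<in>Q. real (\<mu> (e * p ^ Suc i))) \<le> L * (c + \<mu> e)"
    and c: "c \<ge> 0" "L \<ge> 0"
  shows "Suc k * omega_sum \<mu> E (Suc k) \<le> L * (c * card E + omega_sum \<mu> E k)"
proof -
  define Q where "Q f = {(p, i). prime p \<and> \<not> p dvd f \<and> f * p ^ Suc i \<in> E}" for f
  let ?E = "\<lambda>k. {e. e \<in> E \<and> omega e = k}"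
  have finE: "finite (?E k)" for k using E(1) by simp
  have finQ: "finite (Q f)" if "f \<in> E" for f
  proof (rule finite_imageD)
    show "finite ((\<lambda>(p, i). f * p ^ Suc i) ` Q f)" by (rule finite_subset[OF _ E(1)]) (auto simp: Q_def)
    show "inj_on (\<lambda>(p, i). f * p ^ Suc i) (Q f)"
    proof (rule inj_onI, clarify)
      fix p i p' i' assume 1: "(p, i) \<in> Q f" "(p', i') \<in> Q f" "f * p ^ Suc i = f * p' ^ Suc i'"
      then have "p ^ Suc i = p' ^ Suc i'" using E(2)[OF that] by simp
      then show "p = p' \<and> i = i'" using prime_power_inj''[of p p' "Suc i" "Suc i'"] 1 by (auto simp: Q_def)
    qed
  qed
  have "Suc k * omega_sum \<mu> E (Suc k) = (\<Sum>e\<in>?E (Suc k). \<Sum>p\<in>prime_factors e. real (\<mu> e))"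
    unfolding omega_sum_def sum_distrib_left by (intro sum.cong) auto
  also have "\<dots> = (\<Sum>(e, p)\<in>Sigma (?E (Suc k)) prime_factors. real (\<mu> e))"
    using finE by (intro sum.Sigma) auto
  also have "\<dots> = (\<Sum>(f, p, i)\<in>Sigma (?E k) Q. real (\<mu> (f * p ^ Suc i)))"
  proof -
    \<comment> \<open>\<open>f\<close> is \<open>e\<close> without its full power of \<open>p\<close>.\<close>
    define \<psi> where "\<psi> = (\<lambda>(f :: nat, p :: nat, i). (f * p ^ Suc i, p))"
    have "bij_betw \<psi> (Sigma (?E k) Q) (Sigma (?E (Suc k)) prime_factors)"
      unfolding bij_betw_def
    proof
      show "inj_on \<psi> (Sigma (?E k) Q)"
      proof (rule inj_onI)
        fix x y assume xy: "x \<in> Sigma (?E k) Q" "y \<in> Sigma (?E k) Q" "\<psi> x = \<psi> y"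
        obtain f p i f' p' i' where eqs: "x = (f, p, i)" "y = (f', p', i')" by (cases x, cases y)
        have 1: "(p, i) \<in> Q f" "(p', i') \<in> Q f'" using xy eqs by auto
        have p: "p' = p" and e: "f * p ^ Suc i = f' * p ^ Suc i'" using xy(3) eqs by (auto simp: \<psi>_def)
        have "prime p" "\<not> p dvd f" "\<not> p dvd f'" using 1 p by (auto simp: Q_def)
        then have "Suc i = Suc i'"
          using arg_cong[OF e, of "multiplicity p"] unfolding multiplicity_mult_prime_power[OF \<open>prime p\<close> \<open>\<not> p dvd f\<close>]
            multiplicity_mult_prime_power[OF \<open>prime p\<close> \<open>\<not> p dvd f'\<close>] by simp
        moreover from this have "f = f'" using e \<open>prime p\<close> by (simp add: prime_gt_0_nat)
        ultimately show "x = y" using p eqs by simp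
      qed
      show "\<psi> ` Sigma (?E k) Q = Sigma (?E (Suc k)) prime_factors"
      proof (intro equalityI subsetI)
        fix y assume "y \<in> \<psi> ` Sigma (?E k) Q"
        then obtain f p i where y: "y = (f * p ^ Suc i, p)" and f: "f \<in> E" "omega f = k" and q: "(p, i) \<in> Q f"
          by (auto simp: \<psi>_def)
        then have "prime p" "\<not> p dvd f" "f * p ^ Suc i \<in> E" by (auto simp: Q_def)
        with prime_factors_mult_prime_power[OF this(1,2) E(2)[OF f(1)], of i] f
        show "y \<in> Sigma (?E (Suc k)) prime_factors" unfolding y by auto
      next
        fix y assume "y \<in> Sigma (?E (Suc k)) prime_factors"
        then obtain e p where y: "y = (e, p)" "e \<in> E" "omega e = Suc k" "prime p" "p dvd e" by auto
        obtain f i where f: "e = f * p ^ Suc i" "\<not> p dvd f" "f > 0"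
          using prime_power_split[OF y(4,5) E(2)[OF y(2)]] .
        have "f \<in> E" using E(3)[OF y(2)] f(1) by simp
        moreover have "omega f = k" using prime_factors_mult_prime_power(2)[OF y(4) f(2,3), of i] y(3) f(1) by simp
        moreover have "(p, i) \<in> Q f" using y f by (simp add: Q_def)
        ultimately have "(f, p, i) \<in> Sigma (?E k) Q" by simp
        then show "y \<in> \<psi> ` Sigma (?E k) Q" unfolding y(1) f(1) by (rule rev_image_eqI) (simp add: \<psi>_def)
      qed
    qed
    from sum.reindex_bij_betw[OF this, of "\<lambda>(e, p). real (\<mu> e)"] show ?thesis
      by (simp add: \<psi>_def case_prod_unfold)
  qed
  also have "\<dots> = (\<Sum>f\<in>?E k. \<Sum>(p, i)\<in>Q f. real (\<mu> (f * p ^ Suc i)))"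
    using finE finQ by (intro sum.Sigma[symmetric]) auto
  also have "\<dots> \<le> (\<Sum>f\<in>?E k. L * (c + \<mu> f))"
    using finQ E(2) by (intro sum_mono key) (auto simp: Q_def)
  also have "\<dots> = L * (c * card (?E k) + omega_sum \<mu> E k)"
    by (simp add: omega_sum_def sum.distrib sum_distrib_left[symmetric])
  also have "\<dots> \<le> L * (c * card E + omega_sum \<mu> E k)"
    using c E(1) by (intro mult_left_mono add_right_mono) (auto intro!: card_mono)
  finally show ?thesis .
qed

text \<open>Adding \<open>c * card E\<close> makes the recursion homogeneous. As
  \<open>Suc k \<le> L\<close>, the \<open>Suc k\<close> copies of this term cost no more than the
  sum itself, whence the factor \<open>2 * L\<close> at each step.\<close>

lemma omega_sum_le:
  fixes c L :: real
  assumes E: "finite E" "\<And>e. e \<in> E \<Longrightarrow> e > 0" "\<And>e f. e \<in> E \<Longrightarrow> f dvd e \<Longrightarrow> f \<in> E"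
    and key: "\<And>e Q. e > 0 \<Longrightarrow> finite Q \<Longrightarrow> (\<And>p i. (p, i) \<in> Q \<Longrightarrow> prime p \<and> \<not> p dvd e) \<Longrightarrow>
      (\<Sum>(p, i)\<in>Q. real (\<mu> (e * p ^ Suc i))) \<le> L * (c + \<mu> e)"
    and c: "c \<ge> 0" and \<mu>1: "\<mu> 1 = 0" and k: "real k \<le> L"
  shows "c * card E + omega_sum \<mu> E k \<le> (2 * L) ^ k / fact k * (c * card E)"
  using k
proof (induction k)
  case 0
  have "\<mu> e = 0" if "e \<in> E" "omega e = 0" for e
  proof -
    have "prime_factors e = {}" using that(2) by simp
    then have "e = 1" using E(2)[OF that(1)] by (simp add: prime_factorization_empty_iff)
    then show ?thesis using \<mu>1 by simp
  qed
  then have "omega_sum \<mu> E 0 = 0" unfolding omega_sum_def by (intro sum.neutral) auto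
  then show ?case by simp
next
  case (Suc k)
  let ?U = "\<lambda>k. c * card E + omega_sum \<mu> E k"
  have L: "real (Suc k) \<le> L" "L \<ge> 0" using Suc.prems by auto
  have om: "omega_sum \<mu> E k \<ge> 0" unfolding omega_sum_def by (intro sum_nonneg) auto
  have "Suc k * ?U (Suc k) = Suc k * (c * card E) + Suc k * omega_sum \<mu> E (Suc k)"
    by (simp only: distrib_left)
  also have "\<dots> \<le> L * ?U k + L * ?U k"
  proof (rule add_mono)
    show "Suc k * omega_sum \<mu> E (Suc k) \<le> L * ?U k"
      by (rule omega_sum_step[OF E key c L(2)])
    show "Suc k * (c * card E) \<le> L * ?U k" using L c om by (intro mult_mono) auto
  qed
  also have "\<dots> = 2 * L * ?U k" by simp
  also have "\<dots> \<le> 2 * L * ((2 * L) ^ k / fact k * (c * card E))"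
    using Suc L by (intro mult_left_mono) auto
  finally have "?U (Suc k) \<le> 2 * L * ((2 * L) ^ k / fact k * (c * card E)) / Suc k"
    by (simp add: pos_le_divide_eq mult.commute)
  also have "\<dots> = (2 * L) ^ Suc k / fact (Suc k) * (c * card E)" by (simp add: field_simps)
  finally show ?case .
qed

lemma sum_weights_le:
  fixes c L :: real
  assumes E: "finite E" "E \<noteq> {}" "\<And>e. e \<in> E \<Longrightarrow> e > 0" "\<And>e f. e \<in> E \<Longrightarrow> f dvd e \<Longrightarrow> f \<in> E"
    and key: "\<And>e Q. e > 0 \<Longrightarrow> finite Q \<Longrightarrow> (\<And>p i. (p, i) \<in> Q \<Longrightarrow> prime p \<and> \<not> p dvd e) \<Longrightarrow>
      (\<Sum>(p, i)\<in>Q. real (\<mu> (e * p ^ Suc i))) \<le> L * (c + \<mu> e)"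
    and c: "c \<ge> 0" and \<mu>1: "\<mu> 1 = 0"
    and L: "\<And>e. e \<in> E \<Longrightarrow> omega e \<le> L"
    and Y: "\<And>e. e \<in> E \<Longrightarrow> (2 * L) ^ omega e / fact (omega e) \<le> Y"
  shows "(\<Sum>e\<in>E. c + \<mu> e) \<le> (L + 1) * (Y * (c * card E))"
proof -
  let ?K = "omega ` E"
  have fin: "finite ?K" using E(1) by simp
  have K: "card ?K \<ge> 1" using E(1,2) by (simp add: Suc_le_eq card_gt_0_iff)
  have om: "omega_sum \<mu> E k \<ge> 0" for k unfolding omega_sum_def by (intro sum_nonneg) auto
  obtain e0 where e0: "e0 \<in> E" using E(2) by blast
  have L0: "L \<ge> 0" using L[OF e0] by (meson of_nat_0_le_iff order_trans)
  have Y0: "Y \<ge> 0" using Y[OF e0] L0 by (meson divide_nonneg_pos fact_gt_zero mult_nonneg_nonneg order_trans zero_le_numeral zero_le_power)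
  have "(\<Sum>e\<in>E. c + \<mu> e) = c * card E + (\<Sum>e\<in>E. real (\<mu> e))" by (simp add: sum.distrib)
  also have "(\<Sum>e\<in>E. real (\<mu> e)) = (\<Sum>k\<in>?K. omega_sum \<mu> E k)"
    unfolding omega_sum_def by (rule sum.image_gen[OF E(1)])
  \<comment> \<open>One copy of \<open>c * card E\<close> is spent on each value of
    \<open>omega\<close>, to match the left-hand side of \<open>omega_sum_le\<close>.\<close>
  also have "c * card E \<le> card ?K * (c * card E)"
    using mult_right_mono[of 1 "real (card ?K)" "c * card E"] K c by simp
  also have "card ?K * (c * card E) + (\<Sum>k\<in>?K. omega_sum \<mu> E k) = (\<Sum>k\<in>?K. c * card E + omega_sum \<mu> E k)"
    by (simp add: sum.distrib)
  also have "\<dots> \<le> (\<Sum>k\<in>?K. Y * (c * card E))"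
  proof (rule sum_mono)
    fix k assume "k \<in> ?K"
    then obtain e where e: "e \<in> E" "k = omega e" by auto
    have "c * card E + omega_sum \<mu> E k \<le> (2 * L) ^ k / fact k * (c * card E)"
      using L[OF e(1)] e(2) by (intro omega_sum_le[OF E(1,3,4) key c \<mu>1]) auto
    also have "\<dots> \<le> Y * (c * card E)" using Y[OF e(1)] e(2) c by (intro mult_right_mono) auto
    finally show "c * card E + omega_sum \<mu> E k \<le> Y * (c * card E)" .
  qed
  also have "\<dots> = card ?K * (Y * (c * card E))" by simp
  also have "\<dots> \<le> (L + 1) * (Y * (c * card E))"
  proof (rule mult_right_mono)
    have "?K \<subseteq> {..nat \<lfloor>L\<rfloor>}" using L by (auto simp: le_nat_floor)
    then have "card ?K \<le> card {..nat \<lfloor>L\<rfloor>}" by (intro card_mono) auto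
    then have "real (card ?K) \<le> real (Suc (nat \<lfloor>L\<rfloor>))" by simp
    also have "\<dots> \<le> L + 1" using L0 by simp
    finally show "real (card ?K) \<le> L + 1" .
  qed (use Y0 c in auto)
  finally show ?thesis by simp
qed

section \<open>Primes dividing the orders of the roots\<close>

text \<open>The logarithm to base 2 of the product bound, with each prime weakened to 2.\<close>

lemma sum_rmult_prime_powers_le:
  fixes c :: real
  assumes A: "A \<noteq> 0" "degree A \<le> n" and n: "n \<ge> 2" and M: "coeff_norm (cpoly A) \<le> real n powr c"
    and e: "e > 0" and Q: "finite Q" "\<And>p i. (p, i) \<in> Q \<Longrightarrow> prime p \<and> \<not> p dvd e"
  shows "(\<Sum>(p, i)\<in>Q. real (rmult A (e * p ^ Suc i))) \<le> log 2 n * (c + rmult A e)"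
proof -
  let ?s = "\<Sum>(p, i)\<in>Q. rmult A (e * p ^ Suc i)"
  have "2 powr (\<Sum>(p, i)\<in>Q. real (rmult A (e * p ^ Suc i))) = 2 ^ ?s"
    by (simp add: powr_realpow[symmetric] case_prod_unfold)
  also have "\<dots> = (\<Prod>(p, i)\<in>Q. 2 ^ rmult A (e * p ^ Suc i))"
    by (simp add: power_sum case_prod_unfold)
  also have "\<dots> \<le> (\<Prod>(p, i)\<in>Q. real p ^ rmult A (e * p ^ Suc i))"
  proof (intro prod_mono conjI, goal_cases)
    case (2 q)
    obtain p i where q: "q = (p, i)" by (cases q)
    then have "prime p" using 2 Q(2) by blast
    then show ?case unfolding q prod.case using prime_ge_2_nat by (intro power_mono) auto
  qed auto
  also have "\<dots> \<le> coeff_norm (cpoly A) * real n ^ rmult A e"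
    by (rule prod_prime_power_rmult_le[OF A e Q])
  also have "\<dots> \<le> real n powr c * real n powr rmult A e"
    using M n by (intro mult_mono) (auto simp: powr_realpow)
  also have "\<dots> = real n powr (c + rmult A e)" by (simp add: powr_add)
  also have "\<dots> = 2 powr (log 2 n * (c + rmult A e))"
    using n by (simp add: powr_powr[symmetric])
  finally show ?thesis by simp
qed

definition root_orders :: "int poly \<Rightarrow> nat set" where
  "root_orders A = {d. d > 0 \<and> rmult A d > 0}"

lemma
  assumes "A \<noteq> 0"
  shows finite_root_orders: "finite (root_orders A)"
    and sum_totient_root_orders_le: "(\<Sum>d\<in>root_orders A. totient d) \<le> degree A"
proof -
  let ?D = "root_orders A" and ?R = "{z. poly (cpoly A) z = 0}"
  have c0: "cpoly A \<noteq> 0" using assms by simp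
  have finR: "finite ?R" using c0 by (rule poly_roots_finite)
  have sub: "prim_roots d \<subseteq> ?R" if "d \<in> ?D" for d
    using that rmult_pos_iff[OF assms] by (auto simp: root_orders_def)
  \<comment> \<open>One root for each order already shows finiteness, which the count of all
    primitive roots presupposes.\<close>
  have "inj_on (\<lambda>d. cis (2 * pi / real d)) ?D"
  proof (rule inj_onI)
    fix d d' assume d: "d \<in> ?D" "d' \<in> ?D" and eq: "cis (2 * pi / real d) = cis (2 * pi / real d')"
    then have "d > 0" "d' > 0" by (auto simp: root_orders_def)
    from this[THEN prim_roots_cis] show "d = d'" unfolding eq by (rule prim_roots_unique)
  qed
  moreover have "(\<lambda>d. cis (2 * pi / real d)) ` ?D \<subseteq> ?R"
  proof
    fix z assume "z \<in> (\<lambda>d. cis (2 * pi / real d)) ` ?D"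
    then obtain d where d: "d \<in> ?D" "z = cis (2 * pi / real d)" by blast
    then have "z \<in> prim_roots d" by (simp add: prim_roots_cis root_orders_def)
    then show "z \<in> ?R" using sub[OF d(1)] by blast
  qed
  ultimately show fin: "finite ?D" using finR finite_imageD finite_subset by metis
  have "(\<Sum>d\<in>?D. totient d) = (\<Sum>d\<in>?D. card (prim_roots d))"
    by (intro sum.cong refl) (simp add: card_prim_roots root_orders_def)
  also have "\<dots> = card (\<Union>d\<in>?D. prim_roots d)"
    using fin prim_roots_unique
    by (intro card_UN_disjoint[symmetric] ballI impI finite_prim_roots) (auto simp: root_orders_def)
  also have "\<dots> \<le> card ?R" using sub finR by (intro card_mono) auto
  also have "\<dots> \<le> degree A" using poly_roots_degree[OF c0] by simp
  finally show "(\<Sum>d\<in>?D. totient d) \<le> degree A" .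
qed

lemma omega_le_log: "e > 0 \<Longrightarrow> real (omega e) \<le> log 2 e"
  using two_power_omega_le[of e] by (simp add: le_log2_of_power)

text \<open>The quadratic bound only confines \<open>E\<close> to numbers up to \<open>X\<close>,
  but then \<open>omega\<close> is at most log X, and \<open>le_totient_mult_omega\<close> improves
  the count to \<open>y\<close> times a logarithm.\<close>

lemma card_small_totient_le:
  assumes "y \<ge> 1" "4 * y ^ 2 \<le> X" "\<And>e. e \<in> E \<Longrightarrow> e > 0 \<and> real (totient e) < y"
  shows "finite E" "real (card E) \<le> y * (1 + log 2 X)"
    "\<And>e. e \<in> E \<Longrightarrow> real e \<le> X"
proof -
  show X: "real e \<le> X" if "e \<in> E" for e
  proof -
    have "real e \<le> real (4 * totient e ^ 2)" using le_four_totient_square assms(3)[OF that] by (simp only: of_nat_le_iff)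
    also have "\<dots> \<le> 4 * y ^ 2" using assms(3)[OF that] by (simp add: power_mono)
    finally show ?thesis using assms(2) by linarith
  qed
  have y2: "X \<ge> 1" using assms(1,2) one_le_power[OF assms(1), of 2] by linarith
  have le: "real e \<le> y * (1 + log 2 X)" if "e \<in> E" for e
  proof -
    note e = assms(3)[OF that]
    have "real e \<le> real (totient e * Suc (omega e))" using le_totient_mult_omega e by (simp only: of_nat_le_iff)
    also have "\<dots> = real (totient e) * (1 + real (omega e))" by (simp add: algebra_simps)
    also have "\<dots> \<le> y * (1 + log 2 X)"
    proof (rule mult_mono)
      have "log 2 e \<le> log 2 X" using X[OF that] e y2 by simp
      then show "1 + real (omega e) \<le> 1 + log 2 X" using omega_le_log[of e] e by linarith
    qed (use e assms in auto)
    finally show ?thesis .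
  qed
  let ?b = "y * (1 + log 2 X)"
  have sub: "E \<subseteq> {0<..nat \<lfloor>?b\<rfloor>}" using le assms(3) by (auto simp: le_nat_floor)
  then show "finite E" by (rule finite_subset) simp
  have "?b \<ge> 0" using assms(1) y2 by simp
  have "card E \<le> card {0<..nat \<lfloor>?b\<rfloor>}" using sub by (intro card_mono) auto
  then have "real (card E) \<le> real (nat \<lfloor>?b\<rfloor>)" by simp
  also have "\<dots> \<le> ?b" using \<open>?b \<ge> 0\<close> by simp
  finally show "real (card E) \<le> ?b" .
qed

lemma root_orders_le:
  assumes "A \<noteq> 0" "degree A \<le> n" "d \<in> root_orders A"
  shows "totient d \<le> n" "d \<le> 4 * n ^ 2"
proof -
  have "totient d \<le> (\<Sum>d\<in>root_orders A. totient d)"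
    using assms by (intro member_le_sum finite_root_orders) auto
  also have "\<dots> \<le> n" using sum_totient_root_orders_le[OF assms(1)] assms(2) by simp
  finally show t: "totient d \<le> n" .
  have "d \<le> 4 * totient d ^ 2" using assms(3) by (intro le_four_totient_square) (auto simp: root_orders_def)
  also have "\<dots> \<le> 4 * n ^ 2" using t by (intro mult_le_mono2 power_mono) auto
  finally show "d \<le> 4 * n ^ 2" .
qed

lemma card_prime_root_orders_le:
  fixes c y :: real
  assumes A: "A \<noteq> 0" "degree A \<le> n" and n: "n \<ge> 2" and M: "coeff_norm (cpoly A) \<le> real n powr c"
    and y: "y \<ge> 1"
  defines "E \<equiv> {e. e > 0 \<and> real (totient e) < y}"
  shows "real (card (\<Union>d\<in>root_orders A. prime_factors d)) \<le>
    y + 2 * real n / y ^ 2 * log 2 (4 * real n ^ 2) + (\<Sum>e\<in>E. log 2 n * (c + rmult A e))"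
proof -
  let ?D = "root_orders A" and ?L = "log 2 n"
  \<comment> \<open>The threshold is such that an order \<open>e * p ^ Suc i\<close> below it with
    \<open>p > y\<close> has \<open>totient e < y\<close>, because
    \<open>p - 1 \<ge> p / 2 > y / 2\<close>.\<close>
  define D1 where "D1 = {d \<in> ?D. totient d \<ge> y ^ 2 / 2}"
  define Q where "Q e = {(p, i). prime p \<and> \<not> p dvd e \<and> e * p ^ Suc i \<in> ?D}" for e
  define P1 where "P1 = {p. real p \<le> y \<and> p > (0::nat)}"
  define P2 where "P2 = (\<Union>d\<in>D1. prime_factors d)"
  define P3 where "P3 = (\<Union>e\<in>E. fst ` Q e)"
  have finD: "finite ?D" using A(1) by (rule finite_root_orders)
  have finE: "finite E" using y by (intro card_small_totient_le(1)[of y "4 * y ^ 2"]) (auto simp: E_def)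
  have finQ: "finite (Q e)" if "e \<in> E" for e
  proof (rule finite_imageD)
    show "finite ((\<lambda>(p, i). e * p ^ Suc i) ` Q e)" by (rule finite_subset[OF _ finD]) (auto simp: Q_def)
    show "inj_on (\<lambda>(p, i). e * p ^ Suc i) (Q e)"
    proof (rule inj_onI, clarify)
      fix p i p' i' assume 1: "(p, i) \<in> Q e" "(p', i') \<in> Q e" "e * p ^ Suc i = e * p' ^ Suc i'"
      then have "p ^ Suc i = p' ^ Suc i'" using that by (simp add: E_def)
      then show "p = p' \<and> i = i'" using prime_power_inj''[of p p' "Suc i" "Suc i'"] 1 by (auto simp: Q_def)
    qed
  qed
  have P1: "finite P1" "real (card P1) \<le> y"
  proof -
    have sub: "P1 \<subseteq> {0<..nat \<lfloor>y\<rfloor>}" by (auto simp: P1_def le_nat_floor)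
    then show "finite P1" by (rule finite_subset) simp
    have "card P1 \<le> card {0<..nat \<lfloor>y\<rfloor>}" using sub by (intro card_mono) auto
    then have "real (card P1) \<le> real (nat \<lfloor>y\<rfloor>)" by simp
    also have "\<dots> \<le> y" using y by simp
    finally show "real (card P1) \<le> y" .
  qed
  have finD1: "finite D1" using finD by (simp add: D1_def)
  have P2: "finite P2" "real (card P2) \<le> 2 * real n / y ^ 2 * log 2 (4 * real n ^ 2)"
  proof -
    show "finite P2" using finD1 by (auto simp: P2_def)
    have "card D1 * (y ^ 2 / 2) = (\<Sum>d\<in>D1. y ^ 2 / 2)" by simp
    also have "\<dots> \<le> (\<Sum>d\<in>D1. real (totient d))" by (intro sum_mono) (simp add: D1_def)
    also have "\<dots> \<le> (\<Sum>d\<in>?D. real (totient d))" using finD by (intro sum_mono2) (auto simp: D1_def)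
    also have "\<dots> = real (\<Sum>d\<in>?D. totient d)" by simp
    also have "\<dots> \<le> real n" using sum_totient_root_orders_le[OF A(1)] A(2) by (simp only: of_nat_le_iff)
    finally have D1: "card D1 \<le> 2 * real n / y ^ 2" using y by (simp add: field_simps)
    have om: "real (omega d) \<le> log 2 (4 * real n ^ 2)" if "d \<in> D1" for d
    proof -
      have d: "d > 0" "d \<in> ?D" using that by (auto simp: D1_def root_orders_def)
      have "real d \<le> real (4 * n ^ 2)" using root_orders_le(2)[OF A d(2)] by (simp only: of_nat_le_iff)
      then have "log 2 d \<le> log 2 (4 * real n ^ 2)" using d(1) by (intro log_mono) auto
      then show ?thesis using omega_le_log[OF d(1)] by linarith
    qed
    have "card P2 \<le> (\<Sum>d\<in>D1. omega d)" unfolding P2_def using finD1 by (intro card_UN_le)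
    then have "real (card P2) \<le> real (\<Sum>d\<in>D1. omega d)" by (simp only: of_nat_le_iff)
    also have "\<dots> = (\<Sum>d\<in>D1. real (omega d))" by simp
    also have "\<dots> \<le> (\<Sum>d\<in>D1. log 2 (4 * real n ^ 2))" using om by (rule sum_mono)
    also have "\<dots> = card D1 * log 2 (4 * real n ^ 2)" by simp
    also have "\<dots> \<le> 2 * real n / y ^ 2 * log 2 (4 * real n ^ 2)"
    proof (rule mult_right_mono[OF D1])
      have "1 \<le> real n ^ 2" using n by (intro one_le_power) simp
      then show "0 \<le> log 2 (4 * real n ^ 2)" by (subst zero_le_log_cancel_iff) linarith+
    qed
    finally show "real (card P2) \<le> 2 * real n / y ^ 2 * log 2 (4 * real n ^ 2)" .
  qed
  have P3: "finite P3" "real (card P3) \<le> (\<Sum>e\<in>E. ?L * (c + rmult A e))"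
  proof -
    show "finite P3" using finE finQ by (auto simp: P3_def)
    have "card P3 \<le> (\<Sum>e\<in>E. card (fst ` Q e))" unfolding P3_def using finE by (intro card_UN_le)
    also have "\<dots> \<le> (\<Sum>e\<in>E. card (Q e))" using finQ by (intro sum_mono card_image_le)
    finally have "real (card P3) \<le> real (\<Sum>e\<in>E. card (Q e))" by (simp only: of_nat_le_iff)
    also have "\<dots> = (\<Sum>e\<in>E. \<Sum>q\<in>Q e. 1)" by simp
    \<comment> \<open>Each pair in \<open>Q e\<close> stands for the order of an actual root, so it
      is counted with multiplicity at least 1.\<close>
    also have "\<dots> \<le> (\<Sum>e\<in>E. \<Sum>(p, i)\<in>Q e. real (rmult A (e * p ^ Suc i)))"
      by (intro sum_mono) (auto simp: Q_def root_orders_def)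
    also have "\<dots> \<le> (\<Sum>e\<in>E. ?L * (c + rmult A e))"
      using finQ by (intro sum_mono sum_rmult_prime_powers_le[OF A n M]) (auto simp: E_def Q_def)
    finally show "real (card P3) \<le> (\<Sum>e\<in>E. ?L * (c + rmult A e))" .
  qed
  have "(\<Union>d\<in>?D. prime_factors d) \<subseteq> P1 \<union> P2 \<union> P3"
  proof
    fix p assume "p \<in> (\<Union>d\<in>?D. prime_factors d)"
    then obtain d where d: "d \<in> ?D" "prime p" "p dvd d" by auto
    then have d0: "d > 0" by (simp add: root_orders_def)
    show "p \<in> P1 \<union> P2 \<union> P3"
    proof (rule ccontr)
      assume nin: "p \<notin> P1 \<union> P2 \<union> P3"
      have p: "real p > y" using nin d(2) by (auto simp: P1_def prime_gt_0_nat)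
      have "d \<notin> D1" using nin d d0 by (auto simp: P2_def prime_factors_dvd)
      then have t: "totient d < y ^ 2 / 2" using d by (simp add: D1_def)
      obtain e i where e: "d = e * p ^ Suc i" "\<not> p dvd e" "e > 0" using prime_power_split[OF d(2,3) d0] .
      have cop: "coprime e (p ^ Suc i)"
        using prime_imp_coprime[OF d(2) e(2)] by (simp add: coprime_commute)
      have "totient d = totient e * totient (p ^ Suc i)" unfolding e(1) by (rule totient_mult_coprime[OF cop])
      also have "totient (p ^ Suc i) = p ^ i * (p - 1)" using totient_prime_power_Suc[OF d(2)] .
      finally have td: "totient d = totient e * (p ^ i * (p - 1))" .
      have "y / 2 < p / 2" using p by simp
      also have "p / 2 \<le> real (p - 1)" using prime_ge_2_nat[OF d(2)] by (simp add: of_nat_diff)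
      also have "\<dots> = 1 * real (p - 1)" by simp
      also have "\<dots> \<le> real (p ^ i) * real (p - 1)"
        using prime_ge_1_nat[OF d(2)] by (intro mult_right_mono) auto
      finally have q: "y / 2 < real (p ^ i) * real (p - 1)" .
      have "totient e * (y / 2) \<le> totient e * (real (p ^ i) * real (p - 1))" using q by (intro mult_left_mono) auto
      also have "\<dots> = totient d" unfolding td by simp
      also have "\<dots> < y ^ 2 / 2" by (rule t)
      finally have "totient e * y < y * y" by (simp add: power2_eq_square)
      then have "real (totient e) < y" using y by simp
      then have "e \<in> E" using e by (simp add: E_def)
      moreover have "(p, i) \<in> Q e" using e d by (simp add: Q_def)
      ultimately show False using nin by (force simp: P3_def)
    qed
  qed
  then have "card (\<Union>d\<in>?D. prime_factors d) \<le> card (P1 \<union> P2 \<union> P3)"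
    using P1 P2 P3 by (intro card_mono) auto
  also have "\<dots> \<le> card P1 + card P2 + card P3"
    by (meson add_mono_thms_linordered_semiring(3) card_Un_le order_trans)
  finally have "real (card (\<Union>d\<in>?D. prime_factors d)) \<le> real (card P1) + real (card P2) + real (card P3)"
    by (simp only: of_nat_add[symmetric] of_nat_le_iff)
  then show ?thesis using P1 P2 P3 by linarith
qed

section \<open>The least common multiple of the orders\<close>

text \<open>Each maximal prime power of the least common multiple divides a single element of
  \<open>D\<close>, so it is at most \<open>X\<close>.\<close>

lemma common_multiple_le:
  fixes D :: "nat set"
  assumes "finite D" "\<And>d. d \<in> D \<Longrightarrow> d > 0 \<and> d \<le> X"
  obtains k where "k > 0" "\<forall>d\<in>D. d dvd k" "k \<le> X ^ card (\<Union>d\<in>D. prime_factors d)"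
proof
  let ?P = "\<Union>d\<in>D. prime_factors d"
  define b where "b p = Max ((\<lambda>d. multiplicity p d) ` D)" for p
  define k where "k = (\<Prod>p\<in>?P. p ^ b p)"
  have finP: "finite ?P" using assms(1) by auto
  have prime: "prime p" if "p \<in> ?P" for p using that by auto
  show k: "k > 0" unfolding k_def using prime by (intro prod_pos) (auto intro: prime_gt_0_nat)
  have "d dvd k" if d: "d \<in> D" for d
  proof (rule multiplicity_le_imp_dvd)
    show "d \<noteq> 0" using assms(2)[OF d] by simp
    fix p :: nat assume p: "prime p"
    show "multiplicity p d \<le> multiplicity p k"
    proof (cases "p \<in> ?P")
      case True
      have "multiplicity p d \<le> b p" unfolding b_def using assms(1) d by (intro Max_ge) auto
      also have "p ^ b p dvd k" unfolding k_def using True finP by (intro dvd_prodI)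
      then have "b p \<le> multiplicity p k" using k p by (intro multiplicity_geI) auto
      finally show ?thesis .
    next
      case False
      then have "\<not> p dvd d" using p d assms(2)[OF d] by (auto simp: prime_factors_dvd)
      then show ?thesis by (simp add: not_dvd_imp_multiplicity_0)
    qed
  qed
  then show "\<forall>d\<in>D. d dvd k" by blast
  have "p ^ b p \<le> X" if "p \<in> ?P" for p
  proof -
    have "D \<noteq> {}" using that by auto
    then have "b p \<in> (\<lambda>d. multiplicity p d) ` D" unfolding b_def using assms(1) by (intro Max_in) auto
    then obtain d where d: "d \<in> D" "b p = multiplicity p d" by auto
    have "p ^ b p dvd d" unfolding d(2) by (rule multiplicity_dvd)
    then have "p ^ b p \<le> d" using assms(2)[OF d(1)] by (intro dvd_imp_le) auto
    then show ?thesis using assms(2)[OF d(1)] by simp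
  qed
  then have "k \<le> (\<Prod>p\<in>?P. X)" unfolding k_def by (intro prod_mono) auto
  then show "k \<le> X ^ card ?P" by simp
qed

section \<open>Asymptotics\<close>

lemma power_divide_fact_le_exp:
  fixes x :: real
  assumes "x \<ge> 0"
  shows "x ^ k / fact k \<le> exp x"
proof -
  have "(\<Sum>j\<in>{k}. x ^ j /\<^sub>R fact j) \<le> (\<Sum>j. x ^ j /\<^sub>R fact j)"
    using assms by (intro sum_le_suminf summable_exp_generic) auto
  then show ?thesis by (simp add: exp_def divide_inverse mult.commute)
qed

text \<open>The constant \<open>B\<close> is chosen so that \<open>(2 * log 2 n) ^ k\<close> is \<open>(B powr \<delta>) ^ k * (\<delta> * ln n) ^ k\<close>; both
  \<open>B ^ k\<close> and \<open>(\<delta> * ln n) ^ k\<close> are then compared with \<open>fact k\<close>.\<close>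

lemma log_power_divide_fact_le:
  fixes \<delta> n :: real
  assumes "\<delta> > 0" "n > 1" "fact k \<le> n"
  defines "B \<equiv> (2 / (\<delta> * ln 2)) powr (1 / \<delta>)"
  shows "(2 * log 2 n) ^ k / fact k \<le> exp B powr \<delta> * n powr (2 * \<delta>)"
proof -
  define M where "M = 2 / (\<delta> * ln 2)"
  have M: "M > 0" using assms(1) by (simp add: M_def)
  have B: "B > 0" "B powr \<delta> = M" using M assms(1) by (simp_all add: B_def M_def powr_powr)
  have ln: "ln n > 0" using assms(2) by simp
  have "(2 * log 2 n) ^ k / fact k = M ^ k * ((\<delta> * ln n) ^ k / fact k)"
    using assms(1) by (simp add: log_def M_def field_simps power_mult_distrib power_divide)
  also have "\<dots> \<le> (exp B * n) powr \<delta> * n powr \<delta>"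
  proof (intro mult_mono)
    have "B ^ k \<le> exp B * fact k" using power_divide_fact_le_exp[of B k] B by (simp add: field_simps)
    also have "\<dots> \<le> exp B * n" using assms(3) by simp
    finally have "(B ^ k) powr \<delta> \<le> (exp B * n) powr \<delta>" using B assms(1) by (intro powr_mono2) auto
    moreover have "(B ^ k) powr \<delta> = M ^ k"
      using B by (simp add: powr_realpow[symmetric] powr_powr powr_power mult.commute flip: B(2))
    ultimately show "M ^ k \<le> (exp B * n) powr \<delta>" by simp
    have "(\<delta> * ln n) ^ k / fact k \<le> exp (\<delta> * ln n)" using assms(1) ln by (intro power_divide_fact_le_exp) auto
    then show "(\<delta> * ln n) ^ k / fact k \<le> n powr \<delta>" using assms(2) by (simp add: powr_def)
    show "0 \<le> (\<delta> * ln n) ^ k / fact k" using assms(1) ln by simp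
  qed auto
  also have "\<dots> = exp B powr \<delta> * n powr (2 * \<delta>)"
    using assms(2) by (simp add: powr_mult powr_add[symmetric])
  finally show ?thesis .
qed

text \<open>With \<delta> = \<epsilon>/4 the leading term is n^(1/3 + \<epsilon>/2) times powers of
  log n, and the other half of \<epsilon> absorbs these. The term n / y^2 is again n^(1/3).\<close>

lemma eventually_bound_le_powr:
  fixes C \<epsilon> :: real
  assumes "\<epsilon> > 0" "C > 0"
  shows "eventually (\<lambda>n. ln n + (n powr (1 / 3) + 2 * n / (n powr (1 / 3)) ^ 2 * log 2 (4 * n ^ 2) +
    log 2 n * ((log 2 n + 1) * ((C * n powr (2 * (\<epsilon> / 4))) * (n powr (1 / 3) * (1 + log 2 n))))) * ln (4 * n ^ 2)
    \<le> n powr (1 / 3 + \<epsilon>)) at_top"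
  using assms unfolding log_def by real_asymp

text \<open>The assumption \<open>4 * y ^ 2 \<le> n\<close> puts all of \<open>E\<close> below
  \<open>n\<close>; this gives \<open>omega e \<le> L\<close> and
  \<open>fact (omega e) \<le> n\<close>, as the averaged estimate demands.\<close>

lemma card_prime_root_orders_explicit:
  fixes c \<delta> y :: real
  assumes A: "A \<noteq> 0" "degree A \<le> n" "poly A 1 \<noteq> 0" and n2: "n \<ge> 2" and c: "c \<ge> 0" and \<delta>: "\<delta> > 0"
    and M: "coeff_norm (cpoly A) \<le> real n powr c" and y1: "y > 1" and yn: "4 * y ^ 2 \<le> real n"
  defines "L \<equiv> log 2 (real n)" and "B \<equiv> (2 / (\<delta> * ln 2)) powr (1 / \<delta>)"
  shows "real (card (\<Union>d\<in>root_orders A. prime_factors d)) \<le> y + 2 * real n / y ^ 2 * log 2 (4 * real n ^ 2) +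
    L * ((L + 1) * ((exp B powr \<delta> * c * real n powr (2 * \<delta>)) * (y * (1 + L))))"
proof -
  define E where "E = {e. e > 0 \<and> real (totient e) < y}"
  define Y where "Y = exp B powr \<delta> * real n powr (2 * \<delta>)"
  define P where "P = (\<Union>d\<in>root_orders A. prime_factors d)"
  have L0: "L > 0" using n2 by (simp add: L_def)
  have y1': "y \<ge> 1" and EE: "\<And>e. e \<in> E \<Longrightarrow> e > 0 \<and> real (totient e) < y"
    using y1 by (auto simp: E_def)
  note small = card_small_totient_le[of y "real n" E, OF y1' yn EE]
  have finE: "finite E" by (rule small(1))
  have cardE: "card E \<le> y * (1 + L)" unfolding L_def by (rule small(2))
  have En: "e \<le> n" if "e \<in> E" for e using small(3)[OF _ that] by simp
  have "real (card P) \<le> y + 2 * real n / y ^ 2 * log 2 (4 * real n ^ 2) + (\<Sum>e\<in>E. L * (c + rmult A e))"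
    using card_prime_root_orders_le[OF A(1,2) n2 M, of y] y1 by (simp add: P_def L_def E_def)
  also have "(\<Sum>e\<in>E. L * (c + rmult A e)) = L * (\<Sum>e\<in>E. c + rmult A e)" by (simp add: sum_distrib_left)
  also have "(\<Sum>e\<in>E. c + rmult A e) \<le> (L + 1) * (Y * (c * card E))"
  proof (rule sum_weights_le)
    show "E \<noteq> {}" using y1 by (auto simp: E_def intro!: exI[of _ 1])
    show "f \<in> E" if "e \<in> E" "f dvd e" for e f
    proof -
      have e: "e > 0" "real (totient e) < y" using that(1) by (auto simp: E_def)
      then have f: "f > 0" using that(2) by (auto intro: dvd_pos_nat)
      have "totient f \<le> totient e" using totient_dvd[OF that(2)] e by (intro dvd_imp_le) auto
      then show ?thesis using e f by (simp add: E_def)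
    qed
    show "(\<Sum>(p, i)\<in>Q. real (rmult A (e * p ^ Suc i))) \<le> L * (c + real (rmult A e))"
      if "e > 0" "finite Q" "\<And>p i. (p, i) \<in> Q \<Longrightarrow> prime p \<and> \<not> p dvd e" for e Q
      unfolding L_def by (rule sum_rmult_prime_powers_le[OF A(1,2) n2 M that])
    have "poly (cpoly A) 1 = of_int (poly A 1)" by (simp add: poly_altdef)
    moreover have "1 \<in> prim_roots 1" by (simp add: prim_roots_def)
    ultimately show "rmult A 1 = 0" using A(3) rmult_pos_iff[OF A(1), of 1 1] by simp
    fix e assume e: "e \<in> E"
    have e0: "e > 0" using e by (simp add: E_def)
    have "log 2 e \<le> L" unfolding L_def using En[OF e] e0 n2 by (intro log_mono) auto
    then show "real (omega e) \<le> L" using omega_le_log[OF e0] by linarith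
    have "real (fact (omega e)) \<le> real n" using fact_omega_le[OF e0] En[OF e] by (simp only: of_nat_le_iff)
    then show "(2 * L) ^ omega e / fact (omega e) \<le> Y"
      unfolding L_def Y_def B_def using \<delta> n2 by (intro log_power_divide_fact_le) auto
  qed (use finE c in \<open>auto simp: E_def\<close>)
  also have "(L + 1) * (Y * (c * card E)) \<le> (L + 1) * (Y * (c * (y * (1 + L))))"
    using L0 cardE c by (intro mult_left_mono) (auto simp: Y_def)
  also have "Y * (c * (y * (1 + L))) = (exp B powr \<delta> * c * real n powr (2 * \<delta>)) * (y * (1 + L))"
    by (simp add: Y_def)
  finally show ?thesis unfolding P_def using L0 by (simp add: mult_left_mono)
qed

lemma common_multiple_bound:
  fixes c \<epsilon> :: real
  assumes "\<epsilon> > 0"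
  obtains n0 where "\<forall>n\<ge>n0. \<forall>(A :: int poly) m. A \<noteq> 0 \<longrightarrow> degree A \<le> n \<longrightarrow>
    coeff_norm (cpoly A) \<le> real n powr c \<longrightarrow> poly A 1 \<noteq> 0 \<longrightarrow> m > 0 \<longrightarrow> m \<le> n \<longrightarrow>
    (\<exists>k>0. m dvd k \<and> (\<forall>d\<in>root_orders A. d dvd k) \<and> ln (real k) \<le> real n powr (1 / 3 + \<epsilon>))"
proof -
  \<comment> \<open>The exponent \<open>c\<close> may be negative, whereas the averaging wants a
    nonnegative constant and the asymptotics a positive \<open>C\<close>.\<close>
  define c' where "c' = max c 1"
  define \<delta> where "\<delta> = \<epsilon> / 4"
  define B where "B = (2 / (\<delta> * ln 2)) powr (1 / \<delta>)"
  define C where "C = exp B powr \<delta> * c'"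
  have c': "c' \<ge> 1" "c \<le> c'" by (auto simp: c'_def)
  have \<delta>: "\<delta> > 0" using assms by (simp add: \<delta>_def)
  have C: "C > 0" using c' by (simp add: C_def)
  have "eventually (\<lambda>n::real. 4 * (n powr (1 / 3)) ^ 2 \<le> n) at_top" by real_asymp
  with eventually_bound_le_powr[OF assms C] have "eventually (\<lambda>n::real. 4 * (n powr (1 / 3)) ^ 2 \<le> n \<and>
    ln n + (n powr (1 / 3) + 2 * n / (n powr (1 / 3)) ^ 2 * log 2 (4 * n ^ 2) +
    log 2 n * ((log 2 n + 1) * ((C * n powr (2 * \<delta>)) * (n powr (1 / 3) * (1 + log 2 n))))) * ln (4 * n ^ 2)
    \<le> n powr (1 / 3 + \<epsilon>)) at_top" unfolding \<delta>_def by (simp add: eventually_conj_iff)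
  then obtain N where N: "\<And>n::real. n \<ge> N \<Longrightarrow> 4 * (n powr (1 / 3)) ^ 2 \<le> n \<and>
    ln n + (n powr (1 / 3) + 2 * n / (n powr (1 / 3)) ^ 2 * log 2 (4 * n ^ 2) +
    log 2 n * ((log 2 n + 1) * ((C * n powr (2 * \<delta>)) * (n powr (1 / 3) * (1 + log 2 n))))) * ln (4 * n ^ 2)
    \<le> n powr (1 / 3 + \<epsilon>)" unfolding eventually_at_top_linorder by blast
  have main: "\<exists>k>0. m dvd k \<and> (\<forall>d\<in>root_orders A. d dvd k) \<and> ln (real k) \<le> real n powr (1 / 3 + \<epsilon>)"
    if n: "n \<ge> max 2 (nat \<lceil>N\<rceil>)" and A: "A \<noteq> 0" "degree A \<le> n"
      and M: "coeff_norm (cpoly A) \<le> real n powr c" and A1: "poly A 1 \<noteq> 0" and m: "m > 0" "m \<le> n"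
    for n m and A :: "int poly"
  proof -
    define y where "y = real n powr (1 / 3)"
    define L where "L = log 2 (real n)"
    define P where "P = (\<Union>d\<in>root_orders A. prime_factors d)"
    have n2: "n \<ge> 2" and nN: "real n \<ge> N" using n by linarith+
    have y1: "y > 1" using n2 by (simp add: y_def)
    have yn: "4 * y ^ 2 \<le> n" using N[OF nN] by (simp add: y_def)
    have M': "coeff_norm (cpoly A) \<le> real n powr c'"
      using M c' n2 by (elim order_trans) (intro powr_mono, auto)
    have cardP: "real (card P) \<le> y + 2 * real n / y ^ 2 * log 2 (4 * real n ^ 2) +
        L * ((L + 1) * ((C * real n powr (2 * \<delta>)) * (y * (1 + L))))"
      using card_prime_root_orders_explicit[OF A A1 n2 _ \<delta> M' y1 yn] c' by (simp add: P_def L_def C_def B_def)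
    have "d > 0 \<and> d \<le> 4 * n ^ 2" if "d \<in> root_orders A" for d
      using root_orders_le[OF A that] that by (simp add: root_orders_def)
    then obtain k where k: "k > 0" "\<forall>d\<in>root_orders A. d dvd k" "k \<le> (4 * n ^ 2) ^ card P"
      unfolding P_def by (rule common_multiple_le[OF finite_root_orders[OF A(1)]])
    \<comment> \<open>The witness is \<open>m * k\<close>; divisibility by \<open>m\<close> costs
      only \<open>ln n\<close>.\<close>
    have "ln (real (m * k)) = ln (real m) + ln (real k)" using m k by (simp add: ln_mult)
    also have "ln (real m) \<le> ln (real n)" using m by simp
    also have "ln (real k) \<le> card P * ln (4 * real n ^ 2)"
    proof -
      have "real k \<le> real ((4 * n ^ 2) ^ card P)" using k(3) by (simp only: of_nat_le_iff)
      then have "ln (real k) \<le> ln ((4 * real n ^ 2) ^ card P)" using k(1) n2 by (intro ln_mono) auto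
      also have "\<dots> = card P * ln (4 * real n ^ 2)" by (rule ln_realpow)
      finally show ?thesis .
    qed
    also have "card P * ln (4 * real n ^ 2) \<le> (y + 2 * real n / y ^ 2 * log 2 (4 * real n ^ 2) +
        L * ((L + 1) * ((C * real n powr (2 * \<delta>)) * (y * (1 + L))))) * ln (4 * real n ^ 2)"
    proof (rule mult_right_mono[OF cardP])
      have "1 \<le> real n ^ 2" using n2 by (intro one_le_power) simp
      then show "0 \<le> ln (4 * real n ^ 2)" by (intro ln_ge_zero) linarith
    qed
    also have "ln (real n) + \<dots> \<le> real n powr (1 / 3 + \<epsilon>)"
      using N[OF nN] by (simp only: y_def L_def)
    finally have "ln (real (m * k)) \<le> real n powr (1 / 3 + \<epsilon>)" by simp
    moreover have "m * k > 0" "m dvd m * k" "\<forall>d\<in>root_orders A. d dvd m * k" using m k by auto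
    ultimately show ?thesis by blast
  qed
  show ?thesis by (rule that) (intro allI impI main)
qed

section \<open>Eventual periods\<close>

text \<open>This is \<open>p\<close> evaluated at the forward shift operator, so multiplication by
  the variable becomes a shift of the argument.\<close>

definition shift_op :: "complex poly \<Rightarrow> (int \<Rightarrow> complex) \<Rightarrow> int \<Rightarrow> complex" where
  "shift_op p b n = (\<Sum>i\<le>degree p. coeff p i * b (n + int i))"

lemma shift_op_eq: "degree p \<le> N \<Longrightarrow> shift_op p b n = (\<Sum>i\<le>N. coeff p i * b (n + int i))"
  unfolding shift_op_def by (intro sum.mono_neutral_left) (auto simp: coeff_eq_0)

lemma shift_op_0 [simp]: "shift_op 0 b n = 0"
  by (simp add: shift_op_def)

lemma shift_op_add: "shift_op (p + q) b n = shift_op p b n + shift_op q b n"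
proof -
  let ?N = "max (degree p) (degree q)"
  show ?thesis
    by (simp add: shift_op_eq[of _ ?N] degree_add_le algebra_simps sum.distrib)
qed

lemma shift_op_smult: "shift_op (smult c p) b n = c * shift_op p b n"
  using degree_smult_le[of c p] by (simp add: shift_op_eq[of _ "degree p"] sum_distrib_left mult.assoc)

lemma shift_op_diff: "shift_op (p - q) b n = shift_op p b n - shift_op q b n"
proof -
  have "p - q = p + smult (-1) q" by simp
  then show ?thesis by (simp only: shift_op_add shift_op_smult) simp
qed

lemma shift_op_sum: "shift_op (\<Sum>x\<in>S. f x) b n = (\<Sum>x\<in>S. shift_op (f x) b n)"
  by (induction S rule: infinite_finite_induct) (simp_all add: shift_op_add)

lemma shift_op_monom: "shift_op (monom c k) b n = c * b (n + int k)"
proof -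
  have "shift_op (monom c k) b n = (\<Sum>i\<le>k. coeff (monom c k) i * b (n + int i))"
    by (intro shift_op_eq degree_monom_le)
  also have "\<dots> = (\<Sum>i\<le>k. if i = k then c * b (n + int i) else 0)" by (intro sum.cong) auto
  finally show ?thesis by simp
qed

lemma shift_op_1: "shift_op 1 b n = b n"
  using shift_op_monom[of 1 0 b n] by simp

lemma shift_op_pCons_0: "shift_op (pCons 0 p) b n = shift_op p b (n + 1)"
proof -
  have "shift_op (pCons 0 p) b n = (\<Sum>i\<le>Suc (degree p). coeff (pCons 0 p) i * b (n + int i))"
    by (intro shift_op_eq degree_pCons_le)
  also have "\<dots> = shift_op p b (n + 1)"
    by (subst sum.atMost_Suc_shift) (simp add: shift_op_def add_ac)
  finally show ?thesis .
qed

lemma shift_op_monom_mult: "shift_op (monom 1 k * p) b n = shift_op p b (n + int k)"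
proof (induction k arbitrary: n)
  case (Suc k)
  have "monom 1 (Suc k) * p = pCons 0 (monom 1 k * p)" by (simp add: monom_Suc)
  then show ?case using Suc by (simp add: shift_op_pCons_0 add_ac)
qed simp

section \<open>The ideal of eventual annihilators\<close>

definition annihilator :: "(int \<Rightarrow> complex) \<Rightarrow> complex poly set" where
  "annihilator b = {p. eventually (\<lambda>n. shift_op p b n = 0) at_top}"

lemma eventually_shift_int:
  "eventually P (at_top :: int filter) \<Longrightarrow> k \<ge> 0 \<Longrightarrow> eventually (\<lambda>n. P (n + k)) at_top"
  unfolding eventually_at_top_linorder by (meson order_trans le_add_same_cancel1)

lemma annihilator_add: "p \<in> annihilator b \<Longrightarrow> q \<in> annihilator b \<Longrightarrow> p + q \<in> annihilator b"
  unfolding annihilator_def mem_Collect_eq by (drule (1) eventually_conj) (auto elim: eventually_mono simp: shift_op_add)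

lemma annihilator_smult: "p \<in> annihilator b \<Longrightarrow> smult c p \<in> annihilator b"
  unfolding annihilator_def mem_Collect_eq by (auto elim: eventually_mono simp: shift_op_smult)

lemma annihilator_pCons_0: "p \<in> annihilator b \<Longrightarrow> pCons 0 p \<in> annihilator b"
  unfolding annihilator_def mem_Collect_eq shift_op_pCons_0 by (rule eventually_shift_int) auto

lemma annihilator_mult: "p \<in> annihilator b \<Longrightarrow> q * p \<in> annihilator b"
proof (induction q rule: pCons_induct)
  case 0
  then show ?case by (simp add: annihilator_def)
next
  case (pCons a q)
  then show ?case by (simp add: annihilator_add annihilator_smult annihilator_pCons_0)
qed

lemma annihilator_principal:
  assumes "p \<in> annihilator b" "p \<noteq> 0"
  obtains g where "g \<in> annihilator b" "g \<noteq> 0" "\<forall>q\<in>annihilator b. g dvd q"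
proof -
  obtain g where g: "g \<in> annihilator b" "g \<noteq> 0"
    and min: "\<And>q. q \<in> annihilator b \<Longrightarrow> q \<noteq> 0 \<Longrightarrow> degree g \<le> degree q"
    using ex_has_least_nat[of "\<lambda>q. q \<in> annihilator b \<and> q \<noteq> 0" p degree] assms by blast
  have "g dvd q" if q: "q \<in> annihilator b" for q
  proof -
    have "q mod g = q + smult (-1) (q div g * g)" by (simp add: minus_div_mult_eq_mod[symmetric])
    then have "q mod g \<in> annihilator b"
      using q g(1) by (simp only: annihilator_add annihilator_smult annihilator_mult)
    then have "q mod g = 0" using min[of "q mod g"] degree_mod_less[OF g(2), of q] by fastforce
    then show ?thesis by (simp add: mod_eq_0_iff_dvd)
  qed
  with g that show ?thesis by blast
qed

lemma rsquarefree_unity_poly: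
  assumes "n > 0"
  shows "rsquarefree (monom 1 n - 1 :: complex poly)"
  unfolding rsquarefree_roots
  using assms by (auto simp: poly_monom pderiv_diff pderiv_monom power_0_left)

text \<open>The generator \<open>g\<close> of the annihilator divides \<open>x^k0 - 1\<close>, so
  its roots are simple roots of unity. Each of them has an order dividing \<open>m\<close> or lying
  in \<open>root_orders P\<close>, hence dividing \<open>k\<close>; simplicity then gives that
  \<open>g\<close> divides \<open>x^k - 1\<close>, whatever the multiplicities in
  \<open>P\<close>.\<close>

lemma annihilator_unity_poly:
  assumes k0: "monom 1 k0 - 1 \<in> annihilator b" "k0 > 0"
    and P: "(monom 1 m - 1) * cpoly P \<in> annihilator b" "P \<noteq> 0"
    and k: "k > 0" "m dvd k" "\<forall>d\<in>root_orders P. d dvd k"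
  shows "monom 1 k - 1 \<in> annihilator b"
proof -
  have nz: "monom 1 j - 1 \<noteq> (0 :: complex poly)" if "j > 0" for j
    using rsquarefree_unity_poly[OF that] by (auto simp: rsquarefree_def)
  obtain g where g: "g \<in> annihilator b" "g \<noteq> 0" and dvd: "\<forall>q\<in>annihilator b. g dvd q"
    by (rule annihilator_principal[OF k0(1) nz[OF k0(2)]])
  have g1: "g dvd monom 1 k0 - 1" and g2: "g dvd (monom 1 m - 1) * cpoly P" using dvd k0 P by auto
  have sqf: "rsquarefree g"
    unfolding rsquarefree_def
  proof (intro conjI allI)
    fix z
    have "order z g \<le> order z (monom 1 k0 - 1)"
      by (rule dvd_imp_order_le[OF nz[OF k0(2)] g1])
    also have "\<dots> \<le> 1" using rsquarefree_unity_poly[OF k0(2)] unfolding rsquarefree_def by (metis le_numeral_extra(4) zero_le)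
    finally show "order z g = 0 \<or> order z g = 1" by linarith
  qed (use g in auto)
  have root: "z ^ k = 1" if z: "poly g z = 0" for z
  proof -
    have "z ^ k0 = 1" using poly_eq_0_iff_dvd z g1 by (auto elim!: dvdE simp: poly_monom dest: arg_cong[of _ _ "\<lambda>p. poly p z"])
    then obtain d where d: "d > 0" "z \<in> prim_roots d" using root_of_unity_primitive k0(2) by metis
    obtain Q where "(monom 1 m - 1) * cpoly P = g * Q" using g2 by blast
    then have "poly ((monom 1 m - 1) * cpoly P) z = 0" using z by simp
    then have "z ^ m = 1 \<or> poly (cpoly P) z = 0" by (auto simp: poly_monom)
    then have "d dvd m \<or> d \<in> root_orders P"
      using prim_rootsD[OF d(2)] rmult_pos_iff[OF P(2) d(2,1)] d(1) by (auto simp: root_orders_def)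
    then have "d dvd k" using k by (auto intro: dvd_trans)
    then show ?thesis using prim_rootsD[OF d(2)] by simp
  qed
  let ?p = "\<Prod>z | poly g z = 0. [:-z, 1:]"
  have "(\<Prod>z | poly g z = 0. [:-z, 1:] ^ 1) dvd monom 1 k - 1"
    using root nz[OF k(1)] poly_roots_finite[OF g(2)]
    by (intro prod_linear_dvd) (auto simp: Suc_le_eq order_gt_0_iff poly_monom)
  then have "smult (lead_coeff g) ?p dvd monom 1 k - 1" using g(2) by (intro smult_dvd) simp_all
  then have "g dvd monom 1 k - 1" by (simp only: complex_poly_decompose_rsquarefree[OF sqf])
  then obtain Q where "monom 1 k - 1 = g * Q" by blast
  then show ?thesis using annihilator_mult[OF g(1), of Q] by (simp only: mult.commute)
qed

text \<open>Reversing the order of the weights makes the convolution with \<open>A\<close> a combination of forward shifts.\<close>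

definition reversed_poly :: "int multiset \<Rightarrow> int poly" where
  "reversed_poly A = (\<Sum>a\<in>set_mset A. monom (int (count A a)) (nat (Max (set_mset A) - a)))"

section \<open>The representation function as a recurrence for the weights\<close>

lemma rep_fun_eq: "rep_fun A B n = (\<Sum>a\<in>set_mset A. count A a * B (n - a))"
proof -
  have "(\<Sum>a\<in>set_mset A. count A a * B (n - a)) = (\<Sum>a | a \<in># A \<and> n - a \<in> elems B. count A a * B (n - a))"
    by (intro sum.mono_neutral_right) (auto simp: elems_def)
  also have "\<dots> = (\<Sum>(a, b)\<in>(\<lambda>a. (a, n - a)) ` {a. a \<in># A \<and> n - a \<in> elems B}. count A a * B b)"
    by (subst sum.reindex) (auto simp: inj_on_def)
  also have "(\<lambda>a. (a, n - a)) ` {a. a \<in># A \<and> n - a \<in> elems B} = {(a, b). a \<in># A \<and> b \<in> elems B \<and> n = a + b}"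
    by force
  finally show ?thesis by (simp add: rep_fun_def)
qed

text \<open>The exponent belonging to \<open>a\<close> is the maximum minus \<open>a\<close>, so the
  convolution appears translated by the maximum, which is harmless for eventual statements.\<close>

lemma shift_op_reversed_poly:
  assumes "A \<noteq> {#}"
  shows "shift_op (cpoly (reversed_poly A)) (\<lambda>n. of_nat (B n)) n = of_nat (rep_fun A B (n + Max (set_mset A)))"
proof -
  have "n + int (nat (Max (set_mset A) - a)) = n + Max (set_mset A) - a" if "a \<in># A" for a
    using that by simp
  then show ?thesis
    by (simp add: reversed_poly_def add_diff_eq rep_fun_eq hom_distribs shift_op_sum of_int_hom.map_poly_hom_monom shift_op_monom)
qed

lemma reversed_poly_nonneg: "coeff (reversed_poly A) i \<ge> 0"
  unfolding reversed_poly_def coeff_sum by (intro sum_nonneg) auto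

lemma poly_reversed_poly_1: "poly (reversed_poly A) 1 = int (\<Sum>a\<in>set_mset A. count A a)"
  by (simp add: reversed_poly_def poly_sum poly_monom)

lemma degree_reversed_poly: "degree (reversed_poly A) \<le> nat (diam A)"
  unfolding reversed_poly_def
proof (intro degree_sum_le)
  fix a assume a: "a \<in># A"
  have "degree (monom (int (count A a)) (nat (Max (set_mset A) - a))) \<le> nat (Max (set_mset A) - a)"
    by (rule degree_monom_le)
  also have "\<dots> \<le> nat (diam A)" using a by (auto simp: diam_def intro!: nat_mono)
  finally show "degree (monom (int (count A a)) (nat (Max (set_mset A) - a))) \<le> nat (diam A)" .
qed simp

text \<open>This turns the hypothesis on the total weight into one on the coefficient norm.\<close>

lemma coeff_norm_nonneg_poly:
  assumes "\<And>i. coeff P i \<ge> 0"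
  shows "coeff_norm (cpoly P) = of_int (poly P 1)"
  using assms by (simp add: coeff_norm_def poly_altdef)

lemma common_eventual_period:
  assumes A: "A \<noteq> {#}" and B: "eventual_period B k0" and R: "eventual_period (rep_fun A B) m"
    and k: "k > 0" "nat m dvd k" "\<forall>d\<in>root_orders (reversed_poly A). d dvd k"
  shows "eventual_period B (int k)"
proof -
  let ?b = "\<lambda>n. of_nat (B n) :: complex"
  have per: "monom 1 j - 1 \<in> annihilator ?b \<longleftrightarrow> eventually (\<lambda>n. B (n + int j) = B n) at_top" for j
    by (simp add: annihilator_def shift_op_diff shift_op_monom shift_op_1)
  have k0: "k0 > 0" "eventually (\<lambda>n. B (n + int (nat k0)) = B n) at_top"
    using B by (auto simp: eventual_period_def eventually_at_top_linorder)
  have m: "m > 0" "eventually (\<lambda>n. rep_fun A B (n + m) = rep_fun A B n) at_top"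
    using R by (auto simp: eventual_period_def eventually_at_top_linorder)
  let ?h = "Max (set_mset A)"
  obtain N where N: "\<And>n. n \<ge> N \<Longrightarrow> rep_fun A B (n + m) = rep_fun A B n"
    using m(2) unfolding eventually_at_top_linorder by blast
  have "(monom 1 (nat m) - 1) * cpoly (reversed_poly A) \<in> annihilator ?b"
    unfolding annihilator_def mem_Collect_eq eventually_at_top_linorder
  proof (intro exI[of _ "N - ?h"] allI impI)
    fix n assume "n \<ge> N - ?h"
    then have "rep_fun A B (n + ?h + m) = rep_fun A B (n + ?h)" by (intro N) simp
    moreover have "(monom 1 (nat m) - 1) * cpoly (reversed_poly A) =
      monom 1 (nat m) * cpoly (reversed_poly A) - cpoly (reversed_poly A)" by (simp add: algebra_simps)
    ultimately show "shift_op ((monom 1 (nat m) - 1) * cpoly (reversed_poly A)) ?b n = 0"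
      using m(1) by (simp add: shift_op_diff shift_op_monom_mult shift_op_reversed_poly[OF A] add_ac)
  qed
  moreover have "reversed_poly A \<noteq> 0"
  proof
    assume "reversed_poly A = 0"
    then have "int (\<Sum>a\<in>set_mset A. count A a) = 0" using poly_reversed_poly_1[of A] by simp
    then show False using A by (simp flip: size_multiset_overloaded_eq)
  qed
  ultimately have "monom 1 k - 1 \<in> annihilator ?b"
    using annihilator_unity_poly[of "nat k0" ?b "nat m" "reversed_poly A" k] k0 k per[of "nat k0"] by simp
  then have "eventually (\<lambda>n. B (n + int k) = B n) at_top" by (simp only: per)
  then show ?thesis using k(1) by (simp add: eventual_period_def eventually_at_top_linorder)
qed

lemma weight_polynomial:
  assumes A: "A \<noteq> {#}" and B: "eventually_periodic B" and R: "eventual_period (rep_fun A B) m"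
  obtains P where "poly P 1 = int (\<Sum>a\<in>set_mset A. count A a)" "poly P 1 \<noteq> 0" "degree P \<le> nat (diam A)"
    "coeff_norm (cpoly P) = of_int (poly P 1)"
    "\<forall>k>0. nat m dvd k \<longrightarrow> (\<forall>d\<in>root_orders P. d dvd k) \<longrightarrow> eventual_period B (int k)"
proof
  let ?P = "reversed_poly A"
  show 1: "poly ?P 1 = int (\<Sum>a\<in>set_mset A. count A a)" by (rule poly_reversed_poly_1)
  show "poly ?P 1 \<noteq> 0" using A unfolding 1 by (simp flip: size_multiset_overloaded_eq)
  show "degree ?P \<le> nat (diam A)" by (rule degree_reversed_poly)
  show "coeff_norm (cpoly ?P) = of_int (poly ?P 1)" by (intro coeff_norm_nonneg_poly reversed_poly_nonneg)
  obtain k0 where "eventual_period B k0" using B by (auto simp: eventually_periodic_def)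
  then show "\<forall>k>0. nat m dvd k \<longrightarrow> (\<forall>d\<in>root_orders ?P. d dvd k) \<longrightarrow> eventual_period B (int k)"
    using common_eventual_period[OF A _ R] by blast
qed

theorem theorem5:
  fixes c :: real
  assumes "c < 100 * ln 2 - 2"
  shows "\<forall>\<epsilon>::real. \<epsilon> > 0 \<longrightarrow>
    (\<exists>n\<^sub>0::int. \<forall>(A :: int multiset) (B :: int \<Rightarrow> nat) (m :: int) (n :: int).
       card (set_mset A) > 1 \<longrightarrow>
       infinite (elems B) \<longrightarrow>
       eventually_periodic B \<longrightarrow>
       eventual_period (rep_fun A B) m \<longrightarrow>
       n = diam A + m \<longrightarrow>
       n \<ge> n\<^sub>0 \<longrightarrow>
       real (\<Sum>a\<in>set_mset A. count A a) \<le> real_of_int n powr c \<longrightarrow>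
       (\<exists>k. eventual_period B k \<and> ln (real_of_int k) \<le> real_of_int n powr (1 / 3 + \<epsilon>)))"
proof (intro allI impI)
  fix \<epsilon> :: real assume "\<epsilon> > 0"
  then obtain n0 where n0: "\<forall>n\<ge>n0. \<forall>(A :: int poly) m. A \<noteq> 0 \<longrightarrow> degree A \<le> n \<longrightarrow>
    coeff_norm (cpoly A) \<le> real n powr c \<longrightarrow> poly A 1 \<noteq> 0 \<longrightarrow> m > 0 \<longrightarrow> m \<le> n \<longrightarrow>
    (\<exists>k>0. m dvd k \<and> (\<forall>d\<in>root_orders A. d dvd k) \<and> ln (real k) \<le> real n powr (1 / 3 + \<epsilon>))"
    by (rule common_multiple_bound)
  show "\<exists>n\<^sub>0::int. \<forall>(A :: int multiset) (B :: int \<Rightarrow> nat) (m :: int) (n :: int).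
       card (set_mset A) > 1 \<longrightarrow> infinite (elems B) \<longrightarrow> eventually_periodic B \<longrightarrow>
       eventual_period (rep_fun A B) m \<longrightarrow> n = diam A + m \<longrightarrow> n \<ge> n\<^sub>0 \<longrightarrow>
       real (\<Sum>a\<in>set_mset A. count A a) \<le> real_of_int n powr c \<longrightarrow>
       (\<exists>k. eventual_period B k \<and> ln (real_of_int k) \<le> real_of_int n powr (1 / 3 + \<epsilon>))"
  proof (rule exI[of _ "int n0"], intro allI impI)
    fix A :: "int multiset" and B :: "int \<Rightarrow> nat" and m n :: int
    assume A: "card (set_mset A) > 1" and "infinite (elems B)" and B: "eventually_periodic B"
      and R: "eventual_period (rep_fun A B) m" and n: "n = diam A + m" "n \<ge> int n0"
      and le: "real (\<Sum>a\<in>set_mset A. count A a) \<le> real_of_int n powr c"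
    have A0: "A \<noteq> {#}" using A by auto
    have d: "diam A \<ge> 0" using A0 by (auto simp: diam_def)
    have m: "m > 0" using R by (simp add: eventual_period_def)
    obtain P where P: "poly P 1 = int (\<Sum>a\<in>set_mset A. count A a)" "poly P 1 \<noteq> 0" "degree P \<le> nat (diam A)"
      "coeff_norm (cpoly P) = of_int (poly P 1)"
      "\<forall>k>0. nat m dvd k \<longrightarrow> (\<forall>d\<in>root_orders P. d dvd k) \<longrightarrow> eventual_period B (int k)"
      using A0 B R by (rule weight_polynomial)
    \<comment> \<open>As \<open>diam A\<close> is nonnegative and \<open>m\<close> positive,
      \<open>n\<close> loses nothing in passing to natural numbers, and it dominates both the degree
      of \<open>P\<close> and \<open>m\<close>.\<close>
    have nn: "real (nat n) = real_of_int n" using n d m by simp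
    have "\<exists>k>0. nat m dvd k \<and> (\<forall>d\<in>root_orders P. d dvd k) \<and> ln (real k) \<le> real (nat n) powr (1 / 3 + \<epsilon>)"
    proof (rule n0[rule_format])
      show "P \<noteq> 0" using P(2) by auto
      show "degree P \<le> nat n" using P(3) m n(1) by linarith
      show "coeff_norm (cpoly P) \<le> real (nat n) powr c" unfolding P(4) P(1) nn using le by simp
    qed (use n d m P(2) in auto)
    then obtain k where k: "k > 0" "nat m dvd k" "\<forall>d\<in>root_orders P. d dvd k"
      "ln (real k) \<le> real_of_int n powr (1 / 3 + \<epsilon>)" unfolding nn by blast
    then have "eventual_period B (int k)" using P(5) by blast
    with k(4) show "\<exists>k. eventual_period B k \<and> ln (real_of_int k) \<le> real_of_int n powr (1 / 3 + \<epsilon>)"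
      by (intro exI[of _ "int k"]) simp
  qed
qed

end
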